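(* Let $G$ be a general matchgate with input set $X$, omittable set $T$ and output set $Y$, and let $k=|X\cup Y|$. Then there exist two (planar) matchgates $G_1$ and $G_2$, each with $k$ external nodes, such that for all $\alpha\in\{0,1\}^k$, \[ \check{\chi}_G^\alpha=\Gamma_{G_1}^\alpha+\Gamma_{G_2}^\alpha . \]
   Context: A general matchgate is an undirected graph $G=(V,E)$ with complex edge weights (not necessarily planar), whose vertices carry distinct labels from a totally ordered set, together with three pairwise disjoint subsets $X$ (input nodes), $T$ (omittable nodes), $Y$ (output nodes) of $V$ such that every label in $X$ is smaller than every label in $T$, which is smaller than every label in $Y$. Its skew-symmetric matrix $M_G$ (rows/columns in increasing label order) has $(M_G)_{i,j}=w(\{i,j\})$ and $(M_G)_{j,i}=-w(\{i,j\})$ for $i<j$ (weight $0$ if there is no edge), and $\mathrm{Pf}(G)=\mathrm{Pf}(M_G)$, where for an $n\times n$ skew-symmetric $A$ with $n$ even $\mathrm{Pf}(A)=\sum_\pi\epsilon_\pi A_{i_1,i_2}\cdots A_{i_{n-1},i_n}$ over permutations with $i_1<i_2,\ldots$ and $i_1<i_3<\cdots$, $\epsilon_\pi$ the sign of $\pi$ ($\mathrm{Pf}$ of an empty matrix is $1$, of an odd-size matrix $0$). The Pfaffian Sum is $\mathrm{PfS}(G)=\sum_{W\subseteq T}\mathrm{Pf}(G-W)$, where $G-W$ deletes the vertices of $W$ and their incident edges. The external nodes are $X\cup Y$, listed in increasing label order $x_1<\cdots<x_k$; for $\alpha\in\{0,1\}^k$ let $Z_\alpha=\{x_i:\alpha_i=1\}$,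 and the naked character is $\check{\chi}_G^\alpha=\mathrm{PfS}(G-Z_\alpha)$ (with $T$ still the omittable set of $G-Z_\alpha$). A (planar) matchgate is an undirected graph with nonzero complex edge weights, given with a planar embedding, with $k$ external nodes on the outer face numbered $1,\ldots,k$ clockwise; its signature is $\Gamma^\alpha=\mathrm{PerfMatch}(H^\alpha)$, where $H^\alpha$ deletes each external node $i$ with $\alpha_i=1$ and its incident edges, and $\mathrm{PerfMatch}$ is the sum over perfect matchings of the product of edge weights. *)

theory Defs
  imports "HOL-Analysis.Analysis" "HOL-Combinatorics.Permutations"
begin

definition pf :: "nat \<Rightarrow> (nat \<Rightarrow> nat \<Rightarrow> complex) \<Rightarrow> complex" where
  "pf n A = (if odd n then 0 else
     (\<Sum>\<pi> \<in> {\<pi>. \<pi> permutes {..<n}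
                 \<and> (\<forall>j < n div 2. \<pi> (2*j) < \<pi> (2*j+1))
                 \<and> (\<forall>j. j + 1 < n div 2 \<longrightarrow> \<pi> (2*j) < \<pi> (2*j+2))}.
        of_int (sign \<pi>) * (\<Prod>j < n div 2. A (\<pi> (2*j)) (\<pi> (2*j+1)))))"

text \<open>A graph on vertex set V (labels from a linear order) with edge weights given by
  w :: vertex set => complex on 2-element subsets (weight 0 = no edge).\<close>

definition general_matchgate ::
  "'a::linorder set \<Rightarrow> ('a set \<Rightarrow> complex) \<Rightarrow> 'a set \<Rightarrow> 'a set \<Rightarrow> 'a set \<Rightarrow> bool" where
  "general_matchgate V w X T Y \<longleftrightarrow>
     finite V \<and> (\<forall>e. w e \<noteq> 0 \<longrightarrow> e \<subseteq> V \<and> card e = 2)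
     \<and> X \<subseteq> V \<and> T \<subseteq> V \<and> Y \<subseteq> V
     \<and> X \<inter> T = {} \<and> X \<inter> Y = {} \<and> T \<inter> Y = {}
     \<and> (\<forall>x\<in>X. \<forall>t\<in>T. x < t) \<and> (\<forall>t\<in>T. \<forall>y\<in>Y. t < y) \<and> (\<forall>x\<in>X. \<forall>y\<in>Y. x < y)"

definition skew_mat :: "('a::linorder set \<Rightarrow> complex) \<Rightarrow> 'a set \<Rightarrow> nat \<Rightarrow> nat \<Rightarrow> complex" where
  "skew_mat w S i j = (let s = sorted_list_of_set S in
     if i < j then w {s!i, s!j} else if j < i then - w {s!i, s!j} else 0)"

definition Pf_graph :: "('a::linorder set \<Rightarrow> complex) \<Rightarrow> 'a set \<Rightarrow> complex" where
  "Pf_graph w S = pf (card S) (skew_mat w S)"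

definition PfS :: "('a::linorder set \<Rightarrow> complex) \<Rightarrow> 'a set \<Rightarrow> 'a set \<Rightarrow> complex" where
  "PfS w S T = (\<Sum>W \<in> Pow T. Pf_graph w (S - W))"

definition ext_nodes :: "'a::linorder set \<Rightarrow> 'a set \<Rightarrow> 'a list" where
  "ext_nodes X Y = sorted_list_of_set (X \<union> Y)"

definition naked_char ::
  "'a::linorder set \<Rightarrow> ('a set \<Rightarrow> complex) \<Rightarrow> 'a set \<Rightarrow> 'a set \<Rightarrow> 'a set \<Rightarrow> bool list \<Rightarrow> complex" where
  "naked_char V w X T Y \<alpha> =
     PfS w (V - {ext_nodes X Y ! i | i. i < length \<alpha> \<and> \<alpha> ! i}) T"

definition perfect_matchings :: "('a set \<Rightarrow> complex) \<Rightarrow> 'a set \<Rightarrow> 'a set set set" where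
  "perfect_matchings w S = {M. (\<forall>e\<in>M. e \<subseteq> S \<and> card e = 2 \<and> w e \<noteq> 0)
      \<and> (\<forall>e\<in>M. \<forall>e'\<in>M. e \<noteq> e' \<longrightarrow> e \<inter> e' = {}) \<and> \<Union>M = S}"

definition PerfMatch :: "('a set \<Rightarrow> complex) \<Rightarrow> 'a set \<Rightarrow> complex" where
  "PerfMatch w S = (\<Sum>M \<in> perfect_matchings w S. \<Prod>e\<in>M. w e)"

text \<open>A planar embedding into the closed unit disk (complex plane): vertices go to distinct
  points, the j-th external node (0-based, j < k) to the boundary point cis(-2 pi j / k)
  (so external nodes are in clockwise order on the outer face), all other vertices into the
  open disk; each edge {u,v} (u < v) is a simple arc from p u to p v whose interior lies in
  the open disk and avoids all vertex points; distinct edge arcs meet only in common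
  endpoints.\<close>
definition planar_disk_embedding :: "nat set \<Rightarrow> (nat set \<Rightarrow> complex) \<Rightarrow> nat list \<Rightarrow> bool" where
  "planar_disk_embedding V w ext \<longleftrightarrow>
    (\<exists>(p :: nat \<Rightarrow> complex) (\<gamma> :: nat \<Rightarrow> nat \<Rightarrow> real \<Rightarrow> complex).
       inj_on p V
     \<and> (\<forall>j < length ext. p (ext ! j) = cis (- 2 * pi * real j / real (length ext)))
     \<and> (\<forall>v \<in> V - set ext. p v \<in> ball 0 1)
     \<and> (\<forall>u v. u < v \<and> w {u, v} \<noteq> 0 \<longrightarrow>
           arc (\<gamma> u v) \<and> pathstart (\<gamma> u v) = p u \<and> pathfinish (\<gamma> u v) = p v
         \<and> (\<forall>t \<in> {0<..<1}. \<gamma> u v t \<in> ball 0 1 \<and> \<gamma> u v t \<notin> p ` V))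
     \<and> (\<forall>u v u' v'. u < v \<and> w {u, v} \<noteq> 0 \<and> u' < v' \<and> w {u', v'} \<noteq> 0 \<and> (u, v) \<noteq> (u', v') \<longrightarrow>
           path_image (\<gamma> u v) \<inter> path_image (\<gamma> u' v') \<subseteq> p ` ({u, v} \<inter> {u', v'})))"

definition planar_matchgate :: "nat set \<Rightarrow> (nat set \<Rightarrow> complex) \<Rightarrow> nat list \<Rightarrow> bool" where
  "planar_matchgate V w ext \<longleftrightarrow>
     finite V \<and> (\<forall>e. w e \<noteq> 0 \<longrightarrow> e \<subseteq> V \<and> card e = 2)
     \<and> distinct ext \<and> set ext \<subseteq> V \<and> planar_disk_embedding V w ext"

definition signature :: "nat set \<Rightarrow> (nat set \<Rightarrow> complex) \<Rightarrow> nat list \<Rightarrow> bool list \<Rightarrow> complex" where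
  "signature V w ext \<alpha> = PerfMatch w (V - {ext ! i | i. i < length ext \<and> i < length \<alpha> \<and> \<alpha> ! i})"

end

(*
Place the vertices, in label order, on a row of vertical wires and let a circuit of gates act on functions of the set S
of wires that carry a particle. A wire is a path whose consecutive edges alternate between "particle"
and "hole", so a particle hopping to a neighbouring wire, and the annihilation of two neighbouring
particles, are each realized by a single extra edge between two neighbouring wires; the resulting graph
is a grid, hence planar. Three hops compose to a signed exchange of neighbouring wires, and conjugating by
exchanges moves a gate to an arbitrary pair i < j at the cost of the fermionic sign (-1)^(number of
particles strictly between i and j). That is exactly the sign in the expansion of a Pfaffian along its first row,
so a sequence of such annihilations computes S |-> Pf(G[S]).

The Pfaffian Sum is obtained with one additional wire p, placed directly after the omittable
nodes, that records the parity of the number of omitted nodes: omitting t toggles p. Since no external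
node lies between t and p, the fermionic sign of this move is a constant and can be
cancelled by the weight of the gate. The circuit evaluated without p sums the even omissions, the circuit
evaluated with p the odd ones; these are the two planar matchgates.
*)

theory Submission
  imports Defs
begin

text \<open>The obstacle is parity. A planar matchgate has signature 0 wherever an odd number of
  vertices remains, and a gate never changes the parity of the number of particles. Omitting a
  single vertex does change it, so it is no gate on the wires of G alone, and the Pfaffian Sum may
  be nonzero on both parities, which no single planar matchgate achieves. Toggling p together with
  the omission is a gate again: a hop onto p if p is empty, an annihilation with it otherwise. As p
  is joined to nothing in G, every Pfaffian that still contains p vanishes, and this is what selects
  the omissions of one parity. The sign of the exchange is unavoidable: on the two states with one
  particle on two neighbouring wires, hops are shears of determinant 1, whereas a plain exchange has
  determinant -1. The sign that this forces is the one that the Pfaffian asks for. A disk drawing is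
  obtained from a straight-line drawing in a strip of width 2 pi by wrapping it with polar
  coordinates; the wires become radii.\<close>

section \<open>Perfect matchings\<close>

lemma finite_perfect_matchings:
  assumes "finite S" shows "finite (perfect_matchings w S)"
proof (rule finite_subset)
  show "perfect_matchings w S \<subseteq> Pow (Pow S)"
    unfolding perfect_matchings_def by auto
qed (use assms in simp)

lemma perfect_matchings_cong:
  assumes "\<And>e. e \<subseteq> S \<Longrightarrow> card e = 2 \<Longrightarrow> w e = w' e"
  shows "perfect_matchings w S = perfect_matchings w' S"
  unfolding perfect_matchings_def using assms by auto

lemma PerfMatch_cong:
  assumes "\<And>e. e \<subseteq> S \<Longrightarrow> card e = 2 \<Longrightarrow> w e = w' e"
  shows "PerfMatch w S = PerfMatch w' S"
proof -
  have "(\<Prod>e\<in>M. w e) = (\<Prod>e\<in>M. w' e)" if "M \<in> perfect_matchings w' S" for M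
    by (rule prod.cong) (use that assms in \<open>auto simp: perfect_matchings_def\<close>)
  then show ?thesis
    using perfect_matchings_cong[of S w w'] assms unfolding PerfMatch_def by simp
qed

text \<open>Used to pass from the pairs of the grid to the natural numbers that a planar matchgate
  has as vertices. Images under an injective \<open>h\<close> preserve and reflect size,
  disjointness and covering, so the matchings correspond one to one.\<close>

lemma PerfMatch_image:
  assumes "inj h"
  shows "PerfMatch (\<lambda>e. w (h -` e)) (h ` S) = PerfMatch w S"
proof -
  have vi: "h -` (h ` e) = e" for e by (simp add: assms inj_vimage_image_eq)
  have inj: "inj_on ((`) ((`) h)) UNIV"
    using assms by (meson inj_image_eq_iff injI)
  have ch: "card (h ` e) = card e" for e by (meson assms card_image inj_on_subset subset_UNIV)
  have di: "h ` e \<inter> h ` e' = {} \<longleftrightarrow> e \<inter> e' = {}" for e e'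
    by (metis assms image_Int image_is_empty)
  have "perfect_matchings (\<lambda>e. w (h -` e)) (h ` S) = (`) ((`) h) ` perfect_matchings w S" (is "?L = ?R")
  proof
    show "?R \<subseteq> ?L"
    proof
      fix M assume "M \<in> ?R"
      then obtain M' where M': "M = (`) h ` M'" "M' \<in> perfect_matchings w S" by auto
      show "M \<in> ?L"
        using M'(2) assms unfolding M'(1) perfect_matchings_def
        by (simp add: vi ch di inj_image_subset_iff image_Union[symmetric] inj_image_eq_iff)
    qed
    show "?L \<subseteq> ?R"
    proof
      fix M assume M: "M \<in> ?L"
      define M' where "M' = (\<lambda>e. h -` e) ` M"
      have hv: "h ` (h -` e) = e" if "e \<in> M" for e
      proof -
        have "e \<subseteq> h ` S" using M that unfolding perfect_matchings_def by simp
        then have "e \<subseteq> range h" by auto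
        then show ?thesis by (simp add: image_vimage_eq Int_absorb2)
      qed
      have MM: "M = (`) h ` M'"
        unfolding M'_def using hv by (auto simp: image_image)
      have "M' \<in> perfect_matchings w S"
        unfolding perfect_matchings_def
      proof (intro CollectI conjI ballI impI)
        have 1: "h ` e \<in> M" if "e \<in> M'" for e using that MM by blast
        have "h ` \<Union>M' = h ` S" using M MM unfolding perfect_matchings_def image_Union by simp
        then show U: "\<Union>M' = S" using assms by (simp add: inj_image_eq_iff)
        show "e \<subseteq> S" if "e \<in> M'" for e using U that by auto
        show "card e = 2" "w e \<noteq> 0" if "e \<in> M'" for e
          using 1[OF that] M ch[of e] vi[of e] unfolding perfect_matchings_def by auto
        show "e \<inter> e' = {}" if "e \<in> M'" "e' \<in> M'" "e \<noteq> e'" for e e'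
        proof -
          have "h ` e \<noteq> h ` e'" using that(3) assms by (simp add: inj_image_eq_iff)
          then have "h ` e \<inter> h ` e' = {}"
            using M 1[OF that(1)] 1[OF that(2)] unfolding perfect_matchings_def by simp
          then show ?thesis by (simp only: di)
        qed
      qed
      then show "M \<in> ?R" using MM by blast
    qed
  qed
  moreover have "(\<Prod>e\<in>(`) h ` M. w (h -` e)) = (\<Prod>e\<in>M. w e)" for M
    by (subst prod.reindex) (use assms in \<open>auto simp: vi inj_on_def inj_image_eq_iff\<close>)
  moreover have "inj_on ((`) ((`) h)) (perfect_matchings w S)"
    using inj by (meson inj_on_subset subset_UNIV)
  ultimately show ?thesis
    unfolding PerfMatch_def by (simp add: sum.reindex)
qed

text \<open>Matchings are split by whether they contain \<open>e\<close>. Both terms use the weights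
  with \<open>e\<close> deleted, so that in the grid both fall under one evaluation of the graph
  without the gate edge.\<close>

lemma PerfMatch_edge:
  assumes "finite S" "e \<subseteq> S" "card e = 2"
  shows "PerfMatch w S = PerfMatch (w(e := 0)) S + w e * PerfMatch (w(e := 0)) (S - e)"
proof (cases "w e = 0")
  case True
  then have "w(e := 0) = w" by auto
  then show ?thesis using True by simp
next
  case False
  let ?w = "w(e := 0)"
  let ?A = "perfect_matchings ?w S" and ?B = "perfect_matchings ?w (S - e)"
  have ne: "e \<noteq> {}" using assms(3) by auto
  have eB: "e \<notin> M" "\<And>e'. e' \<in> M \<Longrightarrow> e' \<inter> e = {}" if "M \<in> ?B" for M
    using that ne unfolding perfect_matchings_def by auto
  have eq: "perfect_matchings w S = ?A \<union> insert e ` ?B" (is "_ = ?R")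
  proof
    show "?R \<subseteq> perfect_matchings w S"
    proof
      fix M assume "M \<in> ?R"
      then consider "M \<in> ?A" | M' where "M = insert e M'" "M' \<in> ?B" by auto
      then show "M \<in> perfect_matchings w S"
      proof cases
        case 1 then show ?thesis
          unfolding perfect_matchings_def by (auto split: if_splits)
      next
        case 2
        note M' = eB[OF 2(2)]
        have "\<forall>a\<in>M'. a \<subseteq> S \<and> card a = 2 \<and> w a \<noteq> 0" "\<Union>M' = S - e"
          "\<forall>a\<in>M'. \<forall>b\<in>M'. a \<noteq> b \<longrightarrow> a \<inter> b = {}"
          using 2(2) M' unfolding perfect_matchings_def by (auto split: if_splits)
        moreover have "\<forall>a\<in>M'. a \<inter> e = {} \<and> e \<inter> a = {}" using M' by blast
        ultimately show ?thesis
          unfolding perfect_matchings_def 2(1) using False assms by auto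
      qed
    qed
    show "perfect_matchings w S \<subseteq> ?R"
    proof
      fix M assume M: "M \<in> perfect_matchings w S"
      show "M \<in> ?R"
      proof (cases "e \<in> M")
        case False
        then have "M \<in> ?A" using M unfolding perfect_matchings_def by auto
        then show ?thesis by blast
      next
        case True
        have disj: "\<forall>a\<in>M. a \<noteq> e \<longrightarrow> a \<inter> e = {}" and U: "\<Union>M = S"
          using M True unfolding perfect_matchings_def by auto
        have "\<Union>(M - {e}) = S - e" using disj U True by blast
        then have "M - {e} \<in> ?B"
          using M disj unfolding perfect_matchings_def by auto
        moreover have "M = insert e (M - {e})" using True by auto
        ultimately show ?thesis by blast
      qed
    qed
  qed
  have disj: "?A \<inter> insert e ` ?B = {}"
    unfolding perfect_matchings_def by auto
  have inj: "inj_on (insert e) ?B"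
    by (intro inj_onI) (metis Diff_insert_absorb eB(1))
  have fin: "finite ?A" "finite ?B" using assms by (simp_all add: finite_perfect_matchings)
  have cA: "(\<Prod>x\<in>M. w x) = (\<Prod>x\<in>M. ?w x)" if "M \<in> ?A" for M
    by (rule prod.cong) (use that in \<open>auto simp: perfect_matchings_def\<close>)
  have cB: "(\<Prod>x\<in>insert e M. w x) = w e * (\<Prod>x\<in>M. ?w x)" if "M \<in> ?B" for M
  proof -
    have "finite M" using that assms(1) unfolding perfect_matchings_def
      by (auto intro!: finite_UnionD)
    then have "(\<Prod>x\<in>insert e M. w x) = w e * (\<Prod>x\<in>M. w x)" using eB[OF that] by simp
    also have "(\<Prod>x\<in>M. w x) = (\<Prod>x\<in>M. ?w x)"
      using eB(1)[OF that] by (intro prod.cong) auto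
    finally show ?thesis .
  qed
  have "PerfMatch w S = (\<Sum>M\<in>?A. \<Prod>x\<in>M. w x) + (\<Sum>M\<in>insert e ` ?B. \<Prod>x\<in>M. w x)"
    unfolding PerfMatch_def eq by (rule sum.union_disjoint) (use fin disj in auto)
  also have "(\<Sum>M\<in>insert e ` ?B. \<Prod>x\<in>M. w x) = (\<Sum>M\<in>?B. \<Prod>x\<in>insert e M. w x)"
    by (simp add: sum.reindex[OF inj])
  also have "\<dots> = w e * PerfMatch ?w (S - e)"
    unfolding PerfMatch_def sum_distrib_left by (rule sum.cong) (use cB in auto)
  also have "(\<Sum>M\<in>?A. \<Prod>x\<in>M. w x) = PerfMatch ?w S"
    unfolding PerfMatch_def by (rule sum.cong) (use cA in auto)
  finally show ?thesis .
qed

lemma PerfMatch_isolated: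
  assumes "v \<in> S" "\<And>u. u \<in> S \<Longrightarrow> u \<noteq> v \<Longrightarrow> w {v, u} = 0"
  shows "PerfMatch w S = 0"
proof -
  have "perfect_matchings w S = {}"
  proof (rule ccontr)
    assume "perfect_matchings w S \<noteq> {}"
    then obtain M where M: "M \<in> perfect_matchings w S" by auto
    then have "v \<in> \<Union>M" using assms(1) unfolding perfect_matchings_def by simp
    then obtain e where e: "e \<in> M" "v \<in> e" by (rule UnionE)
    have "card e = 2" "w e \<noteq> 0" "e \<subseteq> S" using M e unfolding perfect_matchings_def by auto
    then obtain a b where ab: "e = {a, b}" "a \<noteq> b" by (meson card_2_iff)
    show False
    proof (cases "a = v")
      case True
      then show False using assms(2)[of b] ab \<open>w e \<noteq> 0\<close> \<open>e \<subseteq> S\<close> by auto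
    next
      case False
      then have "e = {v, a}" using ab e by auto
      then show False using assms(2)[of a] False \<open>w e \<noteq> 0\<close> \<open>e \<subseteq> S\<close> by auto
    qed
  qed
  then show ?thesis unfolding PerfMatch_def by simp
qed

lemma PerfMatch_forced:
  assumes "finite S" "v \<in> S" "u \<in> S" "v \<noteq> u"
    and "\<And>x. x \<in> S \<Longrightarrow> x \<noteq> v \<Longrightarrow> x \<noteq> u \<Longrightarrow> w {v, x} = 0"
  shows "PerfMatch w S = w {v, u} * PerfMatch w (S - {v, u})"
proof -
  have "PerfMatch (w({v, u} := 0)) S = 0"
    by (rule PerfMatch_isolated[of v]) (use assms in auto)
  moreover have "PerfMatch (w({v, u} := 0)) (S - {v, u}) = PerfMatch w (S - {v, u})"
    by (rule PerfMatch_cong) auto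
  ultimately show ?thesis
    using PerfMatch_edge[of S "{v, u}" w] assms by simp
qed

text \<open>Inside \<open>S\<close> the vertex \<open>a i\<close> has no neighbour but
  \<open>b i\<close>, so these edges lie in every perfect matching; as their weight is 1, they can
  all be stripped off together.\<close>

lemma PerfMatch_forced_set:
  assumes "finite I" "finite S" "a ` I \<subseteq> S" "b ` I \<subseteq> S" "inj_on a I" "inj_on b I"
    "a ` I \<inter> b ` I = {}"
    and "\<And>i x. i \<in> I \<Longrightarrow> x \<in> S \<Longrightarrow> x \<noteq> a i \<Longrightarrow> x \<noteq> b i \<Longrightarrow> w {a i, x} = 0"
    and "\<And>i. i \<in> I \<Longrightarrow> w {a i, b i} = 1"
  shows "PerfMatch w S = PerfMatch w (S - a ` I - b ` I)"
  using assms
proof (induction I arbitrary: S rule: finite_induct)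
  case empty
  then show ?case by simp
next
  case (insert i I)
  let ?S = "S - {a i, b i}"
  have ai: "a i \<in> S" "b i \<in> S" "a i \<noteq> b i" using insert.prems(2,3,6) by auto
  have na: "a i \<notin> a ` I" "b i \<notin> b ` I" "inj_on a I" "inj_on b I"
    using insert.prems(4,5) insert.hyps(2) by auto
  have nb: "a i \<notin> b ` I" "b i \<notin> a ` I" "a ` I \<inter> b ` I = {}" using insert.prems(6) by auto
  have "PerfMatch w S = w {a i, b i} * PerfMatch w ?S"
    by (rule PerfMatch_forced[OF insert.prems(1) ai]) (rule insert.prems(7)[of i], auto)
  also have "\<dots> = PerfMatch w ?S" using insert.prems(8) by simp
  also have "\<dots> = PerfMatch w (?S - a ` I - b ` I)"
  proof (rule insert.IH)
    show "finite ?S" using insert.prems(1) by simp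
    show "a ` I \<subseteq> ?S" "b ` I \<subseteq> ?S" using insert.prems(2,3) na nb by blast+
    show "w {a i', x} = 0" if "i' \<in> I" "x \<in> ?S" "x \<noteq> a i'" "x \<noteq> b i'" for i' x
      using insert.prems(7)[of i' x] that by blast
    show "w {a i', b i'} = 1" if "i' \<in> I" for i' using insert.prems(8)[of i'] that by blast
  qed (use na nb in blast)+
  also have "?S - a ` I - b ` I = S - a ` insert i I - b ` insert i I" by auto
  finally show ?case .
qed

section \<open>Grid graphs of circuits\<close>

text \<open>A gate \<open>(i, j, d, c)\<close> is an edge of weight \<open>c\<close> from wire \<open>i\<close> to wire \<open>j\<close> whose
  second end lies \<open>d\<close> rows below the first: \<open>d = 0\<close> annihilates two particles, \<open>d = 1\<close> is a hop.
  The first gate of a circuit is the topmost one.\<close>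
type_synonym gate = "nat \<times> nat \<times> nat \<times> complex"

fun gate_sem :: "gate \<Rightarrow> (nat set \<Rightarrow> complex) \<Rightarrow> nat set \<Rightarrow> complex" where
  "gate_sem (i, j, d, c) f S = f S +
     (if d = 0 then if i \<in> S \<and> j \<in> S then c * f (S - {i, j}) else 0
      else if i \<in> S \<and> j \<notin> S then c * f (insert j (S - {i})) else 0)"

text \<open>The value on the empty circuit reflects that a grid of a single row has no edges, so
  that only the empty vertex set has a perfect matching.\<close>

fun circuit_sem :: "gate list \<Rightarrow> nat set \<Rightarrow> complex" where
  "circuit_sem [] = (\<lambda>S. if S = {} then 1 else 0)"
| "circuit_sem (g # gs) = gate_sem g (circuit_sem gs)"

fun valid_gate :: "nat \<Rightarrow> gate \<Rightarrow> bool" where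
  "valid_gate N (i, j, d, c) \<longleftrightarrow> i < N \<and> j < N \<and> (j = Suc i \<or> i = Suc j) \<and> d \<le> 1"

text \<open>A vertex \<open>(i, r)\<close> lies on wire \<open>i\<close> in row \<open>r\<close>. Rows are counted from the bottom, so that prepending a gate
  only adds two rows on top.\<close>
definition grid_vertices :: "nat \<Rightarrow> gate list \<Rightarrow> nat set \<Rightarrow> (nat \<times> nat) set" where
  "grid_vertices N gs S = {..<N} \<times> {..<2 * length gs} \<union> S \<times> {2 * length gs}"

text \<open>The weights cover the whole top row; the input set enters only through
  \<open>grid_vertices\<close>. One weight function thus serves all inputs.\<close>

fun grid_weight :: "nat \<Rightarrow> gate list \<Rightarrow> (nat \<times> nat) set \<Rightarrow> complex" where
  "grid_weight N [] e = 0"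
| "grid_weight N ((i, j, d, c) # gs) e =
    (let s = 2 * length gs in
     if e = {(i, s + 2), (j, s + 2 - d)} then c
     else if \<exists>x<N. e = {(x, s), (x, s + 1)} \<or> e = {(x, s + 1), (x, s + 2)} then 1
     else grid_weight N gs e)"

lemma grid_weight_rows:
  "grid_weight N gs e \<noteq> 0 \<Longrightarrow> list_all (valid_gate N) gs \<Longrightarrow>
    e \<subseteq> {..<N} \<times> {..2 * length gs} \<and> card e = 2"
proof (induction gs)
  case (Cons g gs)
  obtain i j d c where g: "g = (i, j, d, c)" by (rule prod_cases4)
  have ij: "i < N" "j < N" "i \<noteq> j" using Cons.prems(2) unfolding g by auto
  define s where "s = 2 * length gs"
  consider "e = {(i, s + 2), (j, s + 2 - d)}"
    | x where "x < N" "e = {(x, s), (x, s + 1)} \<or> e = {(x, s + 1), (x, s + 2)}"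
    | "grid_weight N gs e \<noteq> 0"
    using Cons.prems(1) unfolding g s_def by (auto simp: Let_def split: if_splits)
  then show ?case
  proof cases
    case 3
    then show ?thesis using Cons by auto
  qed (use ij in \<open>auto simp: s_def\<close>)
qed simp

text \<open>A top vertex must be matched to the middle vertex below it, which leaves the vertex in
  row \<open>s\<close> to the lower grid; a middle vertex without a top vertex takes the vertex in
  row \<open>s\<close> with it. \<open>B\<close> and \<open>C\<close> are left general because a
  gate edge that is used has already removed vertices from one or both rows.\<close>

lemma PerfMatch_two_rows:
  fixes w :: "(nat \<times> nat) set \<Rightarrow> complex"
  assumes w: "\<And>e. w e = (if \<exists>x<N. e = {(x, s), (x, s + 1)} \<or> e = {(x, s + 1), (x, s + 2)} then 1
     else w0 e)"
    and w0: "\<And>e. w0 e \<noteq> 0 \<Longrightarrow> e \<subseteq> {..<N} \<times> {..s}"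
    and BC: "B \<subseteq> {..<N}" "C \<subseteq> {..<N}"
  shows "PerfMatch w ({..<N} \<times> {..<s} \<union> {..<N} \<times> {s} \<union> B \<times> {s + 1} \<union> C \<times> {s + 2}) =
    (if C \<subseteq> B then PerfMatch w0 ({..<N} \<times> {..<s} \<union> ({..<N} - (B - C)) \<times> {s}) else 0)"
    (is "PerfMatch w ?S = _")
proof -
  have fin: "finite B" "finite C" using BC finite_subset by auto
  have finS: "finite ?S" using fin by auto
  have w2: "w {(x, s + 2), v} = (if x < N \<and> v = (x, s + 1) then 1 else 0)" if "v \<noteq> (x, s + 2)" for x v
    using w0[of "{(x, s + 2), v}"] that by (auto simp: w doubleton_eq_iff)
  have w1: "w {(x, s + 1), v} = (if x < N \<and> (v = (x, s) \<or> v = (x, s + 2)) then 1 else 0)" if "v \<noteq> (x, s + 1)" for x v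
    using w0[of "{(x, s + 1), v}"] that by (auto simp: w doubleton_eq_iff)
  show ?thesis
  proof (cases "C \<subseteq> B")
    case False
    then obtain x where x: "x \<in> C" "x \<notin> B" by auto
    have "PerfMatch w ?S = 0"
      by (rule PerfMatch_isolated[of "(x, s + 2)"]) (use x w2 in auto)
    then show ?thesis using False by simp
  next
    case True
    have "PerfMatch w ?S = PerfMatch w (?S - (\<lambda>x. (x, s + 2)) ` C - (\<lambda>x. (x, s + 1)) ` C)"
    proof (rule PerfMatch_forced_set)
      show "w {(i, s + 2), (i, s + 1)} = 1" if "i \<in> C" for i
        using w2[of "(i, s + 1)" i] that BC by auto
      show "w {(i, s + 2), x} = 0" if "x \<noteq> (i, s + 2)" "x \<noteq> (i, s + 1)" for i x
        using w2[of x i] that by auto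
    qed (use fin finS True in \<open>auto simp: inj_on_def\<close>)
    also have "?S - (\<lambda>x. (x, s + 2)) ` C - (\<lambda>x. (x, s + 1)) ` C =
       {..<N} \<times> {..<s} \<union> {..<N} \<times> {s} \<union> (B - C) \<times> {s + 1}" (is "_ = ?S'") by auto
    also have "PerfMatch w ?S' =
        PerfMatch w (?S' - (\<lambda>x. (x, s + 1)) ` (B - C) - (\<lambda>x. (x, s)) ` (B - C))"
    proof (rule PerfMatch_forced_set)
      show "w {(i, s + 1), (i, s)} = 1" if "i \<in> B - C" for i
        using w1[of "(i, s)" i] that BC by auto
      show "w {(i, s + 1), x} = 0" if "x \<in> ?S'" "x \<noteq> (i, s + 1)" "x \<noteq> (i, s)" for i x
        using w1[of x i] that by auto
    qed (use fin BC in \<open>auto simp: inj_on_def\<close>)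
    also have "?S' - (\<lambda>x. (x, s + 1)) ` (B - C) - (\<lambda>x. (x, s)) ` (B - C) =
        {..<N} \<times> {..<s} \<union> ({..<N} - (B - C)) \<times> {s}" (is "_ = ?S''") by auto
    also have "PerfMatch w ?S'' = PerfMatch w0 ?S''"
      by (rule PerfMatch_cong) (auto simp: w)
    finally show ?thesis using True by simp
  qed
qed

lemma PerfMatch_grid:
  assumes "list_all (valid_gate N) gs" "S \<subseteq> {..<N}"
  shows "PerfMatch (grid_weight N gs) (grid_vertices N gs S) = circuit_sem gs S"
  using assms
proof (induction gs arbitrary: S)
  case Nil
  have "perfect_matchings (\<lambda>e. 0) (S \<times> {0::nat}) = (if S = {} then {{}} else {})"
    unfolding perfect_matchings_def by auto
  moreover have "grid_weight N [] = (\<lambda>e. 0)" by auto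
  ultimately show ?case
    unfolding PerfMatch_def grid_vertices_def by simp
next
  case (Cons g gs)
  obtain i j d c where g: "g = (i, j, d, c)" by (rule prod_cases4)
  define s where "s = 2 * length gs"
  define w where "w = grid_weight N (g # gs)"
  define w0 where "w0 = grid_weight N gs"
  define e where "e = {(i, s + 2), (j, s + 2 - d)}"
  define A where "A B C = {..<N} \<times> {..<s} \<union> {..<N} \<times> {s} \<union> B \<times> {s + 1} \<union> C \<times> {s + 2}"
    for B C
  have ij: "i < N" "j < N" "i \<noteq> j" "d = 0 \<or> d = 1" using Cons.prems unfolding g by auto
  have GV: "grid_vertices N (g # gs) S = A {..<N} S"
    unfolding grid_vertices_def A_def s_def by (auto simp: less_Suc_eq)
  have w0r: "e \<subseteq> {..<N} \<times> {..s}" if "w0 e \<noteq> 0" for e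
    using grid_weight_rows[of N gs e] that Cons.prems unfolding w0_def s_def by auto
  have we: "w e = c" unfolding w_def g e_def s_def by (simp add: Let_def)
  have ne: "e \<noteq> {(x, s), (x, s + 1)}" "e \<noteq> {(x, s + 1), (x, s + 2)}" for x
    using ij unfolding e_def by (auto simp: doubleton_eq_iff)
  have w0e: "w0 e = 0" using w0r[of e] unfolding e_def by auto
  have w': "(w(e := 0)) e' =
     (if \<exists>x<N. e' = {(x, s), (x, s + 1)} \<or> e' = {(x, s + 1), (x, s + 2)} then 1 else w0 e')" for e'
  proof (cases "e' = e")
    case True
    show ?thesis using ne w0e unfolding True by simp
  next
    case False
    then show ?thesis unfolding w_def g s_def e_def w0_def by (simp add: Let_def)
  qed
  have two: "PerfMatch (w(e := 0)) (A B C) =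
      (if C \<subseteq> B then circuit_sem gs ({..<N} - (B - C)) else 0)"
    if "B \<subseteq> {..<N}" "C \<subseteq> {..<N}" for B C
  proof -
    have "PerfMatch w0 ({..<N} \<times> {..<s} \<union> ({..<N} - (B - C)) \<times> {s}) = circuit_sem gs ({..<N} - (B - C))"
      using Cons.IH[of "{..<N} - (B - C)"] Cons.prems unfolding w0_def grid_vertices_def s_def by simp
    moreover have "PerfMatch (w(e := 0)) (A B C) =
        (if C \<subseteq> B then PerfMatch w0 ({..<N} \<times> {..<s} \<union> ({..<N} - (B - C)) \<times> {s}) else 0)"
      unfolding A_def by (rule PerfMatch_two_rows) (fact w' w0r that)+
    ultimately show ?thesis by simp
  qed
  have ce: "card e = 2" using ij unfolding e_def by simp
  have SN: "{..<N} - ({..<N} - S) = S" using Cons.prems by auto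
  have finA: "finite (A {..<N} S)" using Cons.prems(2) finite_subset[of S "{..<N}"] unfolding A_def by auto
  have top: "PerfMatch (w(e := 0)) (A {..<N} S) = circuit_sem gs S"
    using two[of "{..<N}" S] Cons.prems SN by simp
  have edge: "PerfMatch w (A {..<N} S) = circuit_sem gs S +
     (if e \<subseteq> A {..<N} S then c * PerfMatch (w(e := 0)) (A {..<N} S - e) else 0)"
  proof (cases "e \<subseteq> A {..<N} S")
    case True
    show ?thesis using PerfMatch_edge[OF finA True ce, of w] True top we by simp
  next
    case False
    have "PerfMatch w (A {..<N} S) = PerfMatch (w(e := 0)) (A {..<N} S)"
      by (rule PerfMatch_cong) (use False in auto)
    then show ?thesis using False top by simp
  qed
  have "PerfMatch w (A {..<N} S) = gate_sem g (circuit_sem gs) S"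
  proof (cases "d = 0")
    case True
    have 1: "e \<subseteq> A {..<N} S \<longleftrightarrow> i \<in> S \<and> j \<in> S" unfolding e_def A_def True by auto
    have 2: "A {..<N} S - e = A {..<N} (S - {i, j})" unfolding e_def A_def True by auto
    have 3: "{..<N} - ({..<N} - (S - {i, j})) = S - {i, j}" using Cons.prems by auto
    show ?thesis using two[of "{..<N}" "S - {i, j}"] Cons.prems True
      unfolding edge 1 2 3 g by auto
  next
    case False
    then have d: "d = 1" using ij by auto
    have 1: "e \<subseteq> A {..<N} S \<longleftrightarrow> i \<in> S" unfolding e_def A_def d using ij by auto
    have 2: "A {..<N} S - e = A ({..<N} - {j}) (S - {i})" unfolding e_def A_def d by auto
    \<comment> \<open>If \<open>j\<close> were occupied, its top vertex would have lost its only
      neighbour; hence a hop needs an empty target.\<close>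
    have 3: "S - {i} \<subseteq> {..<N} - {j} \<longleftrightarrow> j \<notin> S" using Cons.prems ij by auto
    have 4: "{..<N} - ({..<N} - {j} - (S - {i})) = insert j (S - {i})" using Cons.prems ij by auto
    have 5: "S - {i} \<subseteq> {..<N}" using Cons.prems by auto
    show ?thesis using two[of "{..<N} - {j}" "S - {i}"] 5 d
      unfolding edge 1 2 3 4 g by auto
  qed
  then show ?case unfolding GV w_def by simp
qed

section \<open>Realizable functions\<close>

definition realizable :: "nat \<Rightarrow> (nat set \<Rightarrow> complex) \<Rightarrow> bool" where
  "realizable N f \<longleftrightarrow>
    (\<exists>gs. list_all (valid_gate N) gs \<and> (\<forall>S\<subseteq>{..<N}. circuit_sem gs S = f S))"

lemma realizable_cong:
  "realizable N f \<Longrightarrow> (\<And>S. S \<subseteq> {..<N} \<Longrightarrow> f S = g S) \<Longrightarrow> realizable N g"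
  unfolding realizable_def by metis

lemma realizable_empty: "realizable N (\<lambda>S. if S = {} then 1 else 0)"
  unfolding realizable_def by (rule exI[of _ "[]"]) simp

lemma realizable_gate:
  assumes "realizable N f" "valid_gate N g"
  shows "realizable N (gate_sem g f)"
proof -
  obtain gs where gs: "list_all (valid_gate N) gs" "\<And>S. S \<subseteq> {..<N} \<Longrightarrow> circuit_sem gs S = f S"
    using assms(1) unfolding realizable_def by auto
  obtain i j d c where g: "g = (i, j, d, c)" by (rule prod_cases4)
  have "circuit_sem (g # gs) S = gate_sem g f S" if S: "S \<subseteq> {..<N}" for S
  proof -
    have "S - {i, j} \<subseteq> {..<N}" "insert j (S - {i}) \<subseteq> {..<N}"
      using S assms(2) unfolding g by auto
    from this[THEN gs(2)] gs(2)[OF S] show ?thesis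
      unfolding g by (simp only: circuit_sem.simps gate_sem.simps)
  qed
  then show ?thesis
    unfolding realizable_def using gs(1) assms(2) by (intro exI[of _ "g # gs"]) auto
qed

section \<open>Exchanges of neighbouring wires and gates between distant wires\<close>

definition exchange :: "nat \<Rightarrow> nat set \<Rightarrow> nat set" where
  "exchange j S = Transposition.transpose j (Suc j) ` S"

lemma exchange_iff:
  "j \<in> exchange j S \<longleftrightarrow> Suc j \<in> S"
  "Suc j \<in> exchange j S \<longleftrightarrow> j \<in> S"
  "x \<noteq> j \<Longrightarrow> x \<noteq> Suc j \<Longrightarrow> x \<in> exchange j S \<longleftrightarrow> x \<in> S"
  unfolding exchange_def by (force simp: Transposition.transpose_def image_iff split: if_splits)+

lemma exchange_exchange: "exchange j (exchange j S) = S"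
  unfolding exchange_def by (simp add: image_image)

text \<open>On the two states with exactly one particle on the wires \<open>j\<close> and
  \<open>Suc j\<close> this is a quarter turn; \<open>swap_right\<close> is the inverse turn, with
  the sign on the other state.\<close>

definition swap_left :: "nat \<Rightarrow> (nat set \<Rightarrow> complex) \<Rightarrow> nat set \<Rightarrow> complex" where
  "swap_left j f S = (if j \<notin> S \<and> Suc j \<in> S then - 1 else 1) * f (exchange j S)"

definition swap_right :: "nat \<Rightarrow> (nat set \<Rightarrow> complex) \<Rightarrow> nat set \<Rightarrow> complex" where
  "swap_right j f S = (if j \<in> S \<and> Suc j \<notin> S then - 1 else 1) * f (exchange j S)"

lemma exchange_cases:
  "j \<in> S \<Longrightarrow> Suc j \<in> S \<Longrightarrow> exchange j S = S"
  "j \<notin> S \<Longrightarrow> Suc j \<notin> S \<Longrightarrow> exchange j S = S"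
  "j \<in> S \<Longrightarrow> Suc j \<notin> S \<Longrightarrow> exchange j S = insert (Suc j) (S - {j})"
  "j \<notin> S \<Longrightarrow> Suc j \<in> S \<Longrightarrow> exchange j S = insert j (S - {Suc j})"
  unfolding set_eq_iff by (metis exchange_iff insert_iff Diff_iff singletonD)+

text \<open>A quarter turn is a product of three shears: the matrices with rows (1, 1), (0, 1), then
  (1, 0), (-1, 1), then (1, 1), (0, 1) multiply to the one with rows (0, 1), (-1, 0). The opposite
  weights give the inverse turn.\<close>

lemma realizable_swap:
  assumes "realizable N f" "Suc j < N"
  shows "realizable N (swap_left j f)" "realizable N (swap_right j f)"
proof -
  let ?R = "\<lambda>c. gate_sem (j, Suc j, 1, c)" and ?L = "\<lambda>c. gate_sem (Suc j, j, 1, c)"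
  have v: "valid_gate N (j, Suc j, 1, c)" "valid_gate N (Suc j, j, 1, c)" for c
    using assms(2) by auto
  have R: "?R c g S = g S + (if j \<in> S \<and> Suc j \<notin> S then c * g (exchange j S) else 0)" for c g S
    using exchange_cases(3)[of j S] by simp
  have L: "?L c g S = g S + (if j \<notin> S \<and> Suc j \<in> S then c * g (exchange j S) else 0)" for c g S
    using exchange_cases(4)[of j S] by simp
  have "?R 1 (?L (- 1) (?R 1 f)) S = swap_left j f S"
    "?R (- 1) (?L 1 (?R (- 1) f)) S = swap_right j f S" for S
    unfolding R L swap_left_def swap_right_def
    using exchange_cases(1,2)[of j S] by (auto simp: exchange_iff exchange_exchange)
  moreover have "realizable N (?R c (?L d (?R c f)))" for c d
    by (intro realizable_gate assms(1) v)
  ultimately show "realizable N (swap_left j f)" "realizable N (swap_right j f)"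
    by (metis realizable_cong)+
qed

text \<open>The two-wire gate at distance: its weights carry the fermionic sign of the particles in between.\<close>
definition removal :: "nat \<Rightarrow> nat \<Rightarrow> complex \<Rightarrow> complex \<Rightarrow> (nat set \<Rightarrow> complex) \<Rightarrow> nat set \<Rightarrow> complex" where
  "removal i j a b f S = f S + (if i \<in> S then (- 1) ^ card (S \<inter> {i<..<j}) *
     (if j \<in> S then a * f (S - {i, j}) else b * f (insert j (S - {i}))) else 0)"

text \<open>Conjugation by an exchange. In the term \<open>f S\<close> the two turns cancel. In the
  other term the gate changes the contents of the wire between the two turns, and exactly one of
  their signs survives if \<open>j\<close> carries a particle, none otherwise: this is the
  contribution of the wire \<open>j\<close>, which now lies strictly in between.\<close>

lemma removal_Suc:
  assumes "i < j"
  shows "removal i (Suc j) a b f S = swap_right j (removal i j a b (swap_left j f)) S"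
proof -
  have int: "exchange j S \<inter> {i<..<j} = S \<inter> {i<..<j}"
    by (auto simp: exchange_iff)
  have i: "i \<in> exchange j S \<longleftrightarrow> i \<in> S" using assms by (simp add: exchange_iff)
  have ints: "{i<..<Suc j} = insert j {i<..<j}" using assms by auto
  have card: "card (S \<inter> {i<..<Suc j}) = card (S \<inter> {i<..<j}) + (if j \<in> S then 1 else 0)"
    unfolding ints by auto
  have A: "exchange j (exchange j S - {i, j}) = S - {i, Suc j}"
    using assms unfolding set_eq_iff
    by (metis exchange_iff insert_iff Diff_iff singletonD n_not_Suc_n less_irrefl not_less_eq less_SucI)
  have B: "exchange j (insert j (exchange j S - {i})) = insert (Suc j) (S - {i})"
    using assms unfolding set_eq_iff
    by (metis exchange_iff insert_iff Diff_iff singletonD n_not_Suc_n less_irrefl not_less_eq less_SucI)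
  show ?thesis
    using assms unfolding removal_def swap_right_def swap_left_def int i card
    by (auto simp: exchange_iff A B exchange_exchange)
qed

lemma realizable_removal:
  assumes "i < j" "j < N" "realizable N f"
  shows "realizable N (removal i j a b f)"
proof -
  have "Suc i \<le> j" using assms(1) by simp
  then show ?thesis
    using assms(2,3)
  proof (induction j arbitrary: f rule: dec_induct)
    case base
    have v: "valid_gate N (i, Suc i, 0, a)" "valid_gate N (i, Suc i, 1, b)"
      using base by auto
    \<comment> \<open>The two gates do not interact: their conditions on the wire
      \<open>Suc i\<close> exclude each other, and either of them leaves the wire \<open>i\<close>
      empty.\<close>
    have "realizable N (gate_sem (i, Suc i, 0, a) (gate_sem (i, Suc i, 1, b) f))"
      by (intro realizable_gate base v)
    moreover have "{i<..<Suc i} = {}" by auto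
    ultimately show ?case
      by (elim realizable_cong) (auto simp: removal_def)
  next
    case (step j)
    have "realizable N (swap_right j (removal i j a b (swap_left j f)))"
      by (intro realizable_swap step.IH) (use step.prems in auto)
    then show ?case
      by (rule realizable_cong) (use step.hyps in \<open>auto simp: removal_Suc\<close>)
  qed
qed

section \<open>Expansion of the Pfaffian along its first row\<close>

definition matching_perms :: "nat \<Rightarrow> (nat \<Rightarrow> nat) set" where
  "matching_perms n = {\<pi>. \<pi> permutes {..<n}
     \<and> (\<forall>j < n div 2. \<pi> (2*j) < \<pi> (2*j+1))
     \<and> (\<forall>j. j + 1 < n div 2 \<longrightarrow> \<pi> (2*j) < \<pi> (2*j+2))}"

lemma pf_matching_perms:
  "pf n A = (if odd n then 0 else
     (\<Sum>\<pi>\<in>matching_perms n. of_int (sign \<pi>) * (\<Prod>j < n div 2. A (\<pi> (2*j)) (\<pi> (2*j+1)))))"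
  unfolding pf_def matching_perms_def ..

lemma pf_cong:
  assumes "\<And>i j. i < n \<Longrightarrow> j < n \<Longrightarrow> A i j = B i j"
  shows "pf n A = pf n B"
proof -
  have "(\<Prod>j < n div 2. A (\<pi> (2*j)) (\<pi> (2*j+1))) = (\<Prod>j < n div 2. B (\<pi> (2*j)) (\<pi> (2*j+1)))"
    if "\<pi> \<in> matching_perms n" for \<pi>
  proof (rule prod.cong)
    fix j assume "j \<in> {..<n div 2}"
    then have "2 * j < n" "2 * j + 1 < n" by auto
    moreover have "\<pi> permutes {..<n}" using that unfolding matching_perms_def by simp
    ultimately have "\<pi> (2*j) < n" "\<pi> (2*j+1) < n"
      by (metis lessThan_iff permutes_in_image)+
    then show "A (\<pi> (2*j)) (\<pi> (2*j+1)) = B (\<pi> (2*j)) (\<pi> (2*j+1))" by (rule assms)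
  qed simp
  then show ?thesis unfolding pf_matching_perms by simp
qed

text \<open>In one-line notation this is 0, j, 1, ..., j - 1, j + 1, ...: it brings \<open>j\<close>
  next to 0 and keeps the order of all other points, which \<open>skip j\<close> enumerates.\<close>

definition front :: "nat \<Rightarrow> nat \<Rightarrow> nat" where
  "front j x = (if x = 0 then 0 else if x = 1 then j else if x \<le> j then x - 1 else x)"

definition skip :: "nat \<Rightarrow> nat \<Rightarrow> nat" where
  "skip j x = (if x + 2 \<le> j then x + 1 else x + 2)"

lemma front_simps: "front j 0 = 0" "front j (Suc 0) = j" "1 \<le> j \<Longrightarrow> front j (Suc (Suc x)) = skip j x"
  unfolding front_def skip_def by auto

lemma skip_less_iff: "skip j x < skip j y \<longleftrightarrow> x < y"
  unfolding skip_def by auto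

lemma skip_image:
  assumes "1 \<le> j" "j < n + 2"
  shows "skip j ` {..<n} = {..<n + 2} - {0, j}"
proof
  show "{..<n + 2} - {0, j} \<subseteq> skip j ` {..<n}"
  proof
    fix x assume x: "x \<in> {..<n + 2} - {0, j}"
    show "x \<in> skip j ` {..<n}"
      by (rule image_eqI[of _ _ "if x < j then x - 1 else x - 2"]) (use x assms in \<open>auto simp: skip_def\<close>)
  qed
qed (use assms in \<open>auto simp: skip_def\<close>)

text \<open>Each step from \<open>j\<close> to \<open>Suc j\<close> costs one more adjacent
  transposition.\<close>

lemma front_perm:
  assumes "1 \<le> j" "j < n"
  shows "front j permutes {..<n} \<and> sign (front j) = (- 1) ^ (j - 1)"
  using assms
proof (induction j rule: dec_induct)
  case base
  have "front 1 = id" by (auto simp: front_def)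
  moreover have "id permutes {..<n} \<and> sign (id :: nat \<Rightarrow> nat) = (- 1) ^ (1 - 1 :: nat)"
    by (simp only: permutes_id sign_id) simp
  ultimately show ?case by (simp only:)
next
  case (step j)
  have eq: "front (Suc j) = Transposition.transpose j (Suc j) \<circ> front j"
    using step.hyps by (auto simp: front_def fun_eq_iff Transposition.transpose_def)
  have t: "Transposition.transpose j (Suc j) permutes {..<n}"
    using step.prems by (intro permutes_swap_id) auto
  have f: "front j permutes {..<n}" "sign (front j) = (- 1) ^ (j - 1)" using step by auto
  have "sign (front (Suc j)) = - sign (front j)"
    unfolding eq using t f(1)
    by (subst sign_compose) (auto simp: sign_swap_id intro: permutes_imp_permutation[of "{..<n}"])
  also have "\<dots> = (- 1) ^ (Suc j - 1)" using f(2) step.hyps by (cases j) auto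
  finally show ?case using permutes_compose[OF f(1) t] unfolding eq by blast
qed

text \<open>A permutation of \<open>n + 2\<close> points counted by the Pfaffian fixes 0, so it is
  \<open>front j \<circ> lift_perm n \<pi>\<close> with \<open>j\<close> the partner of 0 and \<open>\<pi>\<close> again counted by the Pfaffian.\<close>
definition lift_perm :: "nat \<Rightarrow> (nat \<Rightarrow> nat) \<Rightarrow> nat \<Rightarrow> nat" where
  "lift_perm n = map_permutation {..<n} (\<lambda>x. x + 2)"

lemma lift_perm:
  assumes "\<pi> permutes {..<n}"
  shows "lift_perm n \<pi> permutes {..<n + 2}" "sign (lift_perm n \<pi>) = sign \<pi>"
    "lift_perm n \<pi> 0 = 0" "lift_perm n \<pi> (Suc 0) = Suc 0"
    "lift_perm n \<pi> (Suc (Suc x)) = Suc (Suc (\<pi> x))"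
proof -
  have b: "bij_betw (\<lambda>x. x + 2) {..<n} {2..<n + 2}"
    by (rule bij_betw_byWitness[where f' = "\<lambda>x. x - 2"]) auto
  have p: "lift_perm n \<pi> permutes {2..<n + 2}"
    unfolding lift_perm_def using map_permutation_permutes[OF b assms] .
  then show "lift_perm n \<pi> permutes {..<n + 2}" by (rule permutes_subset) auto
  show "lift_perm n \<pi> 0 = 0" "lift_perm n \<pi> (Suc 0) = Suc 0" using p by (auto simp: permutes_def)
  show "sign (lift_perm n \<pi>) = sign \<pi>"
    unfolding lift_perm_def by (rule sign_map_permutation) (use assms in \<open>auto simp: inj_on_def\<close>)
  show "lift_perm n \<pi> (Suc (Suc x)) = Suc (Suc (\<pi> x))"
  proof (cases "x < n")
    case True
    then have "map_permutation {..<n} (\<lambda>x. x + 2) \<pi> (x + 2) = \<pi> x + 2"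
      by (intro map_permutation_apply[where f = "\<lambda>x. x + 2"]) (auto simp: inj_on_def)
    then show ?thesis unfolding lift_perm_def by simp
  next
    case False
    then have "\<pi> x = x" using assms by (auto simp: permutes_def)
    moreover have "lift_perm n \<pi> (Suc (Suc x)) = Suc (Suc x)"
      using p False by (auto simp: permutes_def)
    ultimately show ?thesis by simp
  qed
qed

text \<open>The first pair is (0, \<open>j\<close>) and meets its order conditions because 0 is
  least; on the later pairs \<open>skip j\<close> is increasing, so the conditions there are those
  on \<open>\<pi>\<close>.\<close>

lemma matching_perms_lift_iff:
  assumes "\<pi> permutes {..<n}" "1 \<le> j" "j < n + 2"
  shows "front j \<circ> lift_perm n \<pi> \<in> matching_perms (n + 2) \<longleftrightarrow> \<pi> \<in> matching_perms n"
proof -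
  let ?\<sigma> = "front j \<circ> lift_perm n \<pi>"
  note l = lift_perm[OF assms(1)]
  have p: "?\<sigma> permutes {..<n + 2}"
    using permutes_compose[OF l(1)] front_perm[OF assms(2,3)] by auto
  have s: "?\<sigma> 0 = 0" "?\<sigma> (Suc 0) = j" "?\<sigma> (Suc (Suc x)) = skip j (\<pi> x)" for x
    using assms(2) by (auto simp: l front_simps)
  have sp: "0 < skip j x" for x unfolding skip_def by auto
  have 1: "(\<forall>i < (n + 2) div 2. ?\<sigma> (2*i) < ?\<sigma> (2*i+1)) \<longleftrightarrow> (\<forall>i < n div 2. \<pi> (2*i) < \<pi> (2*i+1))"
    using assms(2) by (simp add: All_less_Suc2 s skip_less_iff del: o_apply)
  have 2: "(\<forall>i. i + 1 < (n + 2) div 2 \<longrightarrow> ?\<sigma> (2*i) < ?\<sigma> (2*i+2)) \<longleftrightarrow>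
      (\<forall>i. i + 1 < n div 2 \<longrightarrow> \<pi> (2*i) < \<pi> (2*i+2))" (is "?L \<longleftrightarrow> ?R")
  proof
    assume ?L
    show ?R
    proof (intro allI impI)
      fix i assume "i + 1 < n div 2"
      then have "?\<sigma> (2 * Suc i) < ?\<sigma> (2 * Suc i + 2)" using \<open>?L\<close>[rule_format, of "Suc i"] by simp
      then show "\<pi> (2*i) < \<pi> (2*i+2)" by (simp add: s skip_less_iff del: o_apply)
    qed
  next
    assume ?R
    show ?L
    proof (intro allI impI)
      fix i assume i: "i + 1 < (n + 2) div 2"
      show "?\<sigma> (2*i) < ?\<sigma> (2*i+2)"
      proof (cases i)
        case 0
        then show ?thesis by (simp add: s sp numeral_2_eq_2 del: o_apply)
      next
        case (Suc k)
        then have "\<pi> (2*k) < \<pi> (2*k+2)" using \<open>?R\<close> i by simp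
        then show ?thesis unfolding Suc by (simp add: s skip_less_iff del: o_apply)
      qed
    qed
  qed
  show ?thesis unfolding matching_perms_def using 1 2 p assms(1) by blast
qed

text \<open>The first entries of the pairs increase and every second entry exceeds its first one, so
  the value 0 can stand only at the very front.\<close>

lemma matching_perms_0:
  assumes "\<sigma> \<in> matching_perms n" "even n" "0 < n"
  shows "\<sigma> 0 = 0"
proof -
  have p: "\<sigma> permutes {..<n}" and lt: "\<And>j. j < n div 2 \<Longrightarrow> \<sigma> (2*j) < \<sigma> (2*j+1)"
    and st: "\<And>j. j + 1 < n div 2 \<Longrightarrow> \<sigma> (2*j) < \<sigma> (2*j+2)"
    using assms(1) unfolding matching_perms_def by auto
  have ev: "\<sigma> 0 \<le> \<sigma> (2 * j)" if "j < n div 2" for j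
    using that
  proof (induction j)
    case (Suc j)
    then have "\<sigma> (2*j) < \<sigma> (2*j+2)" using st by simp
    then show ?case using Suc by simp
  qed simp
  have "0 \<in> \<sigma> ` {..<n}" using p assms(3) by (simp add: permutes_image)
  then obtain x where x: "x < n" "\<sigma> x = 0" by auto
  have j: "x div 2 < n div 2" using x assms(2) by (auto elim!: evenE)
  show ?thesis
  proof (cases "even x")
    case True
    then show ?thesis using ev[OF j] x by simp
  next
    case False
    then have "\<sigma> (2 * (x div 2)) < \<sigma> x" using lt[OF j] by simp
    then show ?thesis using x by simp
  qed
qed

lemma matching_perms_Suc_Suc:
  assumes "even n"
  shows "bij_betw (\<lambda>(j, \<pi>). front j \<circ> lift_perm n \<pi>) ({1..<n + 2} \<times> matching_perms n) (matching_perms (n + 2))"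
  unfolding bij_betw_def
proof
  have perm: "\<pi> permutes {..<n}" if "\<pi> \<in> matching_perms n" for \<pi> and n
    using that unfolding matching_perms_def by simp
  show "inj_on (\<lambda>(j, \<pi>). front j \<circ> lift_perm n \<pi>) ({1..<n + 2} \<times> matching_perms n)"
  proof (rule inj_onI, clarify)
    fix j \<pi> j' \<pi>'
    assume *: "j \<in> {1..<n+2}" "j' \<in> {1..<n+2}" "\<pi> \<in> matching_perms n" "\<pi>' \<in> matching_perms n"
      and eq: "front j \<circ> lift_perm n \<pi> = front j' \<circ> lift_perm n \<pi>'"
    note l = lift_perm[OF perm[OF *(3)]] lift_perm[OF perm[OF *(4)]]
    have j: "j = j'" using fun_cong[OF eq, of "Suc 0"] by (simp add: l front_simps)
    have "\<pi> x = \<pi>' x" for x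
    proof -
      have "skip j (\<pi> x) = skip j (\<pi>' x)"
        using fun_cong[OF eq, of "Suc (Suc x)"] * unfolding j by (simp add: l front_simps)
      then show ?thesis using skip_less_iff by (metis linorder_neqE_nat less_irrefl)
    qed
    then show "j = j' \<and> \<pi> = \<pi>'" using j by auto
  qed
  show "(\<lambda>(j, \<pi>). front j \<circ> lift_perm n \<pi>) ` ({1..<n + 2} \<times> matching_perms n) = matching_perms (n + 2)"
    (is "?f ` _ = _")
  proof
    show "?f ` ({1..<n + 2} \<times> matching_perms n) \<subseteq> matching_perms (n + 2)"
      using matching_perms_lift_iff perm by fastforce
    show "matching_perms (n + 2) \<subseteq> ?f ` ({1..<n + 2} \<times> matching_perms n)"
    proof
      fix \<sigma> assume \<sigma>: "\<sigma> \<in> matching_perms (n + 2)"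
      have p: "\<sigma> permutes {..<n + 2}" using perm[OF \<sigma>] .
      have 0: "\<sigma> 0 = 0" using matching_perms_0[OF \<sigma>] assms by simp
      define j where "j = \<sigma> 1"
      have "\<sigma> (2 * 0) < \<sigma> (2 * 0 + 1)"
        using \<sigma> assms unfolding matching_perms_def mem_Collect_eq by (metis zero_less_Suc add_2_eq_Suc' div2_Suc_Suc)
      then have j: "1 \<le> j" "j < n + 2"
        using 0 permutes_in_image[OF p, of 1] unfolding j_def by auto
      have fp: "front j permutes {..<n + 2}" using front_perm[OF j] by simp
      \<comment> \<open>Undoing \<open>front j\<close> leaves a permutation that fixes 0 and 1;
        shifting it down by 2 gives the preimage.\<close>
      define \<tau> where "\<tau> = inv (front j) \<circ> \<sigma>"
      have ft: "front j \<circ> \<tau> = \<sigma>"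
        unfolding \<tau>_def o_assoc using permutes_inv_o(1)[OF fp] by simp
      have t: "\<tau> permutes {..<n + 2}"
        unfolding \<tau>_def using permutes_compose[OF p permutes_inv[OF fp]] .
      have "front j (\<tau> 0) = front j 0" "front j (\<tau> 1) = front j 1"
        using fun_cong[OF ft] 0 by (auto simp: front_simps j_def)
      then have t01: "\<tau> 0 = 0" "\<tau> 1 = 1"
        using permutes_inj[OF fp] by (auto dest: injD)
      have t2: "\<tau> permutes {2..<n + 2}"
      proof (rule permutes_superset[OF t])
        fix x assume "x \<in> {..<n + 2} - {2..<n + 2}"
        then have "x = 0 \<or> x = 1" by auto
        then show "\<tau> x = x" using t01 by auto
      qed
      define \<pi> where "\<pi> = map_permutation {2..<n + 2} (\<lambda>x. x - 2) \<tau>"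
      have b: "bij_betw (\<lambda>x. x - 2) {2..<n + 2} {..<n}"
        by (rule bij_betw_byWitness[where f' = "\<lambda>x. x + 2"]) auto
      have pi: "\<pi> permutes {..<n}" unfolding \<pi>_def by (rule map_permutation_permutes[OF b t2])
      have "lift_perm n \<pi> = \<tau>"
        unfolding lift_perm_def \<pi>_def
        by (rule map_permutation_compose_inv[OF b t2]) auto
      then have eq: "front j \<circ> lift_perm n \<pi> = \<sigma>" using ft by simp
      then have "\<pi> \<in> matching_perms n" using matching_perms_lift_iff[OF pi j] \<sigma> by simp
      then show "\<sigma> \<in> ?f ` ({1..<n + 2} \<times> matching_perms n)"
        using eq j by (intro image_eqI[of _ _ "(j, \<pi>)"]) auto
    qed
  qed
qed

lemma pf_expand:
  "pf (n + 2) A = (\<Sum>j = 1..<n + 2. (- 1) ^ (j - 1) * A 0 j * pf n (\<lambda>x y. A (skip j x) (skip j y)))"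
proof (cases "even n")
  case False
  then show ?thesis by (simp add: pf_matching_perms)
next
  case True
  define F where "F \<sigma> = complex_of_int (sign \<sigma>) * (\<Prod>i < (n + 2) div 2. A (\<sigma> (2*i)) (\<sigma> (2*i+1)))" for \<sigma>
  define G where "G j \<pi> = complex_of_int (sign \<pi>) *
      (\<Prod>i < n div 2. A (skip j (\<pi> (2*i))) (skip j (\<pi> (2*i+1))))" for j \<pi>
  have F: "F (front j \<circ> lift_perm n \<pi>) = (- 1) ^ (j - 1) * A 0 j * G j \<pi>"
    if j: "j \<in> {1..<n+2}" and "\<pi> \<in> matching_perms n" for j \<pi>
  proof -
    have pi: "\<pi> permutes {..<n}" using that unfolding matching_perms_def by simp
    note l = lift_perm[OF pi]
    have j1: "1 \<le> j" "j < n + 2" using j by auto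
    note f = front_perm[OF j1]
    have "sign (front j \<circ> lift_perm n \<pi>) = (- 1) ^ (j - 1) * sign \<pi>"
      using f l(1,2) by (subst sign_compose) (auto intro: permutes_imp_permutation[of "{..<n+2}"])
    then show ?thesis
      unfolding F_def G_def using j1
      by (simp add: prod.lessThan_Suc_shift l front_simps del: prod.lessThan_Suc)
  qed
  have "pf (n + 2) A = (\<Sum>\<sigma>\<in>matching_perms (n + 2). F \<sigma>)"
    using True unfolding pf_matching_perms F_def by simp
  also have "\<dots> = (\<Sum>(j, \<pi>)\<in>{1..<n+2} \<times> matching_perms n. F (front j \<circ> lift_perm n \<pi>))"
    using sum.reindex_bij_betw[OF matching_perms_Suc_Suc[OF True], of F] by (simp add: case_prod_beta)
  also have "\<dots> = (\<Sum>j = 1..<n+2. \<Sum>\<pi>\<in>matching_perms n. F (front j \<circ> lift_perm n \<pi>))"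
    by (simp add: sum.cartesian_product)
  also have "\<dots> = (\<Sum>j = 1..<n+2. (- 1) ^ (j - 1) * A 0 j * (\<Sum>\<pi>\<in>matching_perms n. G j \<pi>))"
    unfolding sum_distrib_left by (intro sum.cong refl F)
  finally show ?thesis using True unfolding pf_matching_perms[of n] G_def by simp
qed

text \<open>As \<open>skip j\<close> is increasing, the list on the right is sorted. Hence deleting
  two vertices, one of them the first, amounts to deleting their rows and columns from the
  matrix.\<close>

lemma sorted_list_of_set_Diff_pair:
  assumes "finite S" "card S = n + 2" "1 \<le> j" "j < n + 2"
  defines "s \<equiv> sorted_list_of_set S"
  shows "sorted_list_of_set (S - {s ! 0, s ! j}) = map (\<lambda>x. s ! skip j x) [0..<n]"
proof -
  have s: "sorted_wrt (<) s" "set s = S" "length s = n + 2" "distinct s"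
    using assms by (auto simp: s_def)
  have lt: "skip j x < n + 2" if "x < n" for x using that unfolding skip_def by auto
  have set: "set (map (\<lambda>x. s ! skip j x) [0..<n]) = S - {s ! 0, s ! j}"
  proof -
    have "set (map (\<lambda>x. s ! skip j x) [0..<n]) = (!) s ` skip j ` {..<n}"
      by (simp add: image_image lessThan_atLeast0)
    also have "\<dots> = (!) s ` ({..<n + 2} - {0, j})" by (simp only: skip_image[OF assms(3,4)])
    also have "\<dots> = (!) s ` {..<n + 2} - (!) s ` {0, j}"
      using s assms by (intro inj_on_image_set_diff[of _ "{..<n+2}"]) (auto simp: inj_on_nth)
    also have "(!) s ` {..<n + 2} = S" using s by (metis lessThan_atLeast0 nth_image order_refl take_all)
    finally show ?thesis by simp
  qed
  have "sorted_wrt (<) (map (\<lambda>x. s ! skip j x) [0..<n])"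
    unfolding sorted_wrt_iff_nth_less
    using s(3) lt by (auto intro!: sorted_wrt_nth_less[OF s(1)] simp: skip_less_iff)
  moreover have "card (S - {s ! 0, s ! j}) = n"
  proof -
    have "distinct (map (\<lambda>x. s ! skip j x) [0..<n])"
      using calculation by (simp add: strict_sorted_iff)
    then show ?thesis using distinct_card set by fastforce
  qed
  ultimately show ?thesis
    using sorted_list_of_set_unique[of "S - {s ! 0, s ! j}"] set assms(1)
    by (metis finite_Diff length_map length_upt minus_nat.diff_0)
qed

lemma Pf_graph_empty: "Pf_graph w {} = 1"
proof -
  have "matching_perms 0 = {id}" unfolding matching_perms_def by auto
  then show ?thesis unfolding Pf_graph_def by (simp add: pf_matching_perms)
qed

text \<open>The expansion in terms of vertices instead of positions. Its exponent counts the
  vertices of \<open>S\<close> strictly between the two removed ones, which is the exponent in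
  \<open>removal\<close>.\<close>

lemma Pf_graph_expand:
  assumes "finite S" "S \<noteq> {}"
  shows "Pf_graph w S = (\<Sum>v\<in>S - {Min S}. (- 1) ^ card {u\<in>S. Min S < u \<and> u < v} *
     w {Min S, v} * Pf_graph w (S - {Min S, v}))"
proof (cases "card S = 1")
  case True
  then obtain m where "S = {m}" by (auto simp: card_1_singleton_iff)
  then show ?thesis by (simp add: Pf_graph_def pf_matching_perms)
next
  case False
  have "card S \<noteq> 0" using assms by simp
  then obtain n where n: "card S = n + 2" using False by (metis One_nat_def add_2_eq_Suc' not0_implies_Suc)
  define s where "s = sorted_list_of_set S"
  have s: "sorted_wrt (<) s" "set s = S" "length s = n + 2" "distinct s"
    using assms n by (auto simp: s_def)
  have S: "S = (!) s ` {..<n + 2}" using s by (metis lessThan_atLeast0 nth_image order_refl take_all)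
  have nth_less: "s ! i < s ! j \<longleftrightarrow> i < j" if "i < n + 2" "j < n + 2" for i j
    using sorted_wrt_nth_less[OF s(1)] s(3) that by (metis linorder_neqE_nat order_less_asym)
  have m: "Min S = s ! 0"
  proof (rule Min_eqI)
    show "s ! 0 \<le> y" if y: "y \<in> S" for y
    proof -
      obtain i where "i < n + 2" "y = s ! i" using y unfolding S by auto
      then show ?thesis using nth_less[of 0 i] by (cases i) auto
    qed
  qed (use assms S in auto)
  have inj: "inj_on ((!) s) {..<n + 2}" using s by (simp add: inj_on_nth)
  have bij: "bij_betw ((!) s) {1..<n + 2} (S - {Min S})"
  proof -
    have "(!) s ` ({..<n + 2} - {0}) = S - (!) s ` {0}"
      unfolding S by (rule inj_on_image_set_diff[OF inj]) auto
    moreover have "{..<n + 2} - {0} = {1..<n + 2}" by auto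
    ultimately show ?thesis unfolding bij_betw_def m using inj_on_subset[OF inj, of "{1..<n + 2}"] by auto
  qed
  have cardj: "card {u\<in>S. s ! 0 < u \<and> u < s ! j} = j - 1" if "j \<in> {1..<n + 2}" for j
  proof -
    have "{u\<in>S. s ! 0 < u \<and> u < s ! j} = (!) s ` {0<..<j}"
      unfolding S using that by (auto simp: nth_less)
    moreover have "inj_on ((!) s) {0<..<j}" by (rule inj_on_subset[OF inj]) (use that in auto)
    ultimately show ?thesis by (simp add: card_image)
  qed
  have sub: "Pf_graph w (S - {s ! 0, s ! j}) = pf n (\<lambda>x y. skew_mat w S (skip j x) (skip j y))"
    if "j \<in> {1..<n + 2}" for j
  proof -
    have l: "sorted_list_of_set (S - {s ! 0, s ! j}) = map (\<lambda>x. s ! skip j x) [0..<n]"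
      unfolding s_def by (rule sorted_list_of_set_Diff_pair) (use that assms n in auto)
    then have "card (S - {s ! 0, s ! j}) = n"
      by (metis length_map length_upt minus_nat.diff_0 sorted_list_of_set.length_sorted_key_list_of_set)
    then show ?thesis
      unfolding Pf_graph_def
      by (simp, intro pf_cong) (simp add: skew_mat_def l Let_def skip_less_iff flip: s_def)
  qed
  have "Pf_graph w S = (\<Sum>j = 1..<n + 2. (- 1) ^ (j - 1) * w {s ! 0, s ! j} *
      pf n (\<lambda>x y. skew_mat w S (skip j x) (skip j y)))"
    unfolding Pf_graph_def n pf_expand by (rule sum.cong) (auto simp: skew_mat_def Let_def s_def)
  also have "\<dots> = (\<Sum>j = 1..<n + 2. (- 1) ^ card {u\<in>S. s ! 0 < u \<and> u < s ! j} * w {s ! 0, s ! j} *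
      Pf_graph w (S - {s ! 0, s ! j}))"
    by (rule sum.cong) (simp_all only: cardj sub)
  also have "\<dots> = (\<Sum>v\<in>S - {Min S}. (- 1) ^ card {u\<in>S. s ! 0 < u \<and> u < v} * w {s ! 0, v} *
      Pf_graph w (S - {s ! 0, v}))"
    by (rule sum.reindex_bij_betw[OF bij])
  finally show ?thesis unfolding m .
qed

section \<open>Circuits for Pfaffians and Pfaffian Sums\<close>

text \<open>Annihilations of \<open>i\<close> with one possible partner after the other. After any
  one of them \<open>i\<close> is empty and the remaining gates act as the identity, so no product
  of two of them occurs and the result is a sum over the partners.\<close>

lemma realizable_removals:
  assumes "realizable N f" "J \<le> N"
  shows "realizable N (\<lambda>S. f S + (if i \<in> S then \<Sum>j\<in>{j\<in>S. i < j \<and> j < J}.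
    (- 1) ^ card (S \<inter> {i<..<j}) * u j * f (S - {i, j}) else 0))"
  using assms(2)
proof (induction J)
  case 0
  show ?case by (rule realizable_cong[OF assms(1)]) simp
next
  case (Suc J)
  let ?g = "\<lambda>J S. f S + (if i \<in> S then \<Sum>j\<in>{j\<in>S. i < j \<and> j < J}.
    (- 1) ^ card (S \<inter> {i<..<j}) * u j * f (S - {i, j}) else 0)"
  have g: "realizable N (?g J)" using Suc by simp
  show ?case
  proof (cases "i < J")
    case False
    then have eq: "{j\<in>S. i < j \<and> j < Suc J} = {j\<in>S. i < j \<and> j < J}" for S by auto
    show ?thesis unfolding eq by (rule g)
  next
    case True
    have "realizable N (removal i J (u J) 0 (?g J))"
      by (rule realizable_removal[OF True _ g]) (use Suc in simp)
    then show ?thesis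
    proof (rule realizable_cong)
      fix S :: "nat set"
      have "{j\<in>S. i < j \<and> j < Suc J} = (if J \<in> S then insert J {j\<in>S. i < j \<and> j < J} else {j\<in>S. i < j \<and> j < J})"
        using True by (auto simp: less_Suc_eq)
      moreover have "finite {j\<in>S. i < j \<and> j < J}" by (rule finite_subset[of _ "{..<J}"]) auto
      ultimately show "removal i J (u J) 0 (?g J) S = ?g (Suc J) S"
        by (simp add: removal_def algebra_simps)
    qed
  qed
qed

text \<open>Downward induction on the least wire \<open>i\<close> in use. The previous function
  vanishes on every set containing \<open>i\<close>, so a particle on \<open>i\<close> has to be
  annihilated with a later one, and \<open>i\<close> is the minimum of any set that contributes:
  this is the expansion along the first row.\<close>

lemma realizable_Pf_graph:
  fixes w :: "nat set \<Rightarrow> complex"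
  shows "realizable N (Pf_graph w)"
proof -
  have "realizable N (\<lambda>S. if S \<subseteq> {i..} then Pf_graph w S else 0)" if "i \<le> N" for i
    using that
  proof (induction rule: inc_induct)
    case base
    show ?case
    proof (rule realizable_cong[OF realizable_empty])
      fix S assume "S \<subseteq> {..<N}"
      then have "S \<subseteq> {N..} \<longleftrightarrow> S = {}" by (auto simp: subset_iff) (meson leD)
      then show "(if S = {} then 1 else 0) = (if S \<subseteq> {N..} then Pf_graph w S else 0)"
        by (simp add: Pf_graph_empty)
    qed
  next
    case (step i)
    let ?f = "\<lambda>S. if S \<subseteq> {Suc i..} then Pf_graph w S else 0"
    show ?case
    proof (rule realizable_cong[OF realizable_removals[OF step.IH order_refl, of i "\<lambda>j. w {i, j}"]])
      fix S :: "nat set" assume S: "S \<subseteq> {..<N}"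
      let ?s = "\<Sum>j\<in>{j\<in>S. i < j \<and> j < N}. (- 1) ^ card (S \<inter> {i<..<j}) * w {i, j} * ?f (S - {i, j})"
      consider "i \<notin> S" | "i \<in> S" "S \<subseteq> {i..}" | "i \<in> S" "\<not> S \<subseteq> {i..}" by auto
      then show "?f S + (if i \<in> S then ?s else 0) = (if S \<subseteq> {i..} then Pf_graph w S else 0)"
      proof cases
        case 1
        then have "S \<subseteq> {Suc i..} \<longleftrightarrow> S \<subseteq> {i..}"
          by (metis Diff_insert_absorb atLeast_Suc_greaterThan greaterThan_iff atLeast_iff le_eq_less_or_eq subset_iff)
        then show ?thesis using 1 by simp
      next
        case 2
        have fin: "finite S" by (rule finite_subset[OF S]) simp
        have m: "Min S = i" by (rule Min_eqI) (use 2 fin in auto)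
        have "Pf_graph w S = (\<Sum>v\<in>S - {i}. (- 1) ^ card {u\<in>S. i < u \<and> u < v} * w {i, v} * Pf_graph w (S - {i, v}))"
          using Pf_graph_expand[OF fin, of w] 2 unfolding m by auto
        also have "\<dots> = ?s"
        proof (rule sum.cong)
          show "S - {i} = {j\<in>S. i < j \<and> j < N}" using 2 S by force
          fix j assume "j \<in> {j\<in>S. i < j \<and> j < N}"
          have "{u\<in>S. i < u \<and> u < j} = S \<inter> {i<..<j}" by auto
          moreover have "S - {i, j} \<subseteq> {Suc i..}" using 2 by (force simp: Suc_le_eq)
          ultimately show "(- 1) ^ card {u\<in>S. i < u \<and> u < j} * w {i, j} * Pf_graph w (S - {i, j}) =
            (- 1) ^ card (S \<inter> {i<..<j}) * w {i, j} * ?f (S - {i, j})" by simp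
        qed
        finally show ?thesis using 2 by auto
      next
        case 3
        then obtain x where x: "x \<in> S" "x < i" by (metis atLeast_iff not_le subsetI)
        have "?s = 0"
        proof (rule sum.neutral, rule ballI)
          fix j assume "j \<in> {j\<in>S. i < j \<and> j < N}"
          then have "x \<in> S - {i, j}" using x by auto
          then have "\<not> S - {i, j} \<subseteq> {Suc i..}" using x by (metis Suc_leD atLeast_iff leD subsetD)
          then show "(- 1) ^ card (S \<inter> {i<..<j}) * w {i, j} * ?f (S - {i, j}) = 0" by simp
        qed
        moreover have "\<not> S \<subseteq> {Suc i..}" using 3 by (meson Suc_leD atLeast_iff subset_iff)
        ultimately show ?thesis using 3 by simp
      qed
    qed
  qed
  from this[of 0] show ?thesis by simp
qed

section \<open>Omissions and the parity wire\<close>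

definition toggle :: "'a \<Rightarrow> 'a set \<Rightarrow> nat \<Rightarrow> 'a set" where
  "toggle p S n = (if even n then S else if p \<in> S then S - {p} else insert p S)"

lemma toggle_Suc: "toggle p (toggle p S (Suc 0)) n = toggle p S (Suc n)"
  unfolding toggle_def by auto

text \<open>The induction adds ever smaller elements on top, so whenever the gate of
  \<open>t\<close> acts, only smaller elements have been removed. All wires from \<open>t\<close> up
  to \<open>p\<close> are then still occupied, and the fermionic sign is the constant
  \<open>c\<close>, independent of the omissions made before.\<close>

lemma realizable_subset_sum:
  assumes "realizable N f" "finite T" "T \<subseteq> {..<p}" "p < N"
  shows "\<exists>F. realizable N F \<and> (\<forall>S\<subseteq>{..<N}. (\<forall>t\<in>T. {t..<p} \<subseteq> S) \<longrightarrow>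
    F S = (\<Sum>W\<in>Pow T. f (toggle p (S - W) (card W))))"
  using assms(2,3)
proof (induction T rule: finite_linorder_min_induct)
  case empty
  then show ?case using assms(1) by (intro exI[of _ f]) (simp add: toggle_def)
next
  case (insert t T)
  then obtain F where F: "realizable N F"
    "\<And>S. S \<subseteq> {..<N} \<Longrightarrow> (\<forall>t\<in>T. {t..<p} \<subseteq> S) \<Longrightarrow>
      F S = (\<Sum>W\<in>Pow T. f (toggle p (S - W) (card W)))" by auto
  have t: "t < p" using insert.prems by simp
  have tT: "t \<notin> T" using insert.hyps by auto
  define c where "c = (- 1 :: complex) ^ card {t<..<p}"
  have cc: "c * c = 1" unfolding c_def by (simp add: power_mult_distrib[symmetric])
  show ?case
  proof (intro exI conjI allI impI)
    \<comment> \<open>Annihilation with \<open>p\<close> and hop onto \<open>p\<close> get the same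
      weight, since both mean that \<open>t\<close> is omitted; with the sign it gives
      \<open>c * c = 1\<close>.\<close>
    show "realizable N (removal t p c c F)" by (rule realizable_removal[OF t assms(4) F(1)])
    fix S assume S: "S \<subseteq> {..<N}" "\<forall>t\<in>insert t T. {t..<p} \<subseteq> S"
    let ?S = "toggle p (S - {t}) 1"
    have tS: "t \<in> S" using S(2) t by auto
    have "S \<inter> {t<..<p} = {t<..<p}" using S(2) by auto
    then have sg: "(- 1) ^ card (S \<inter> {t<..<p}) = c" unfolding c_def by (simp only:)
    have "removal t p c c F S =
        F S + (c * c) * (if p \<in> S then F (S - {t, p}) else F (insert p (S - {t})))"
      unfolding removal_def sg using tS by simp
    also have "(if p \<in> S then F (S - {t, p}) else F (insert p (S - {t}))) = F ?S"
    proof -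
      have "S - {t} - {p} = S - {t, p}" by auto
      then show ?thesis unfolding toggle_def using t by simp
    qed
    finally have "removal t p c c F S = F S + F ?S" using cc by simp
    also have "F S = (\<Sum>W\<in>Pow T. f (toggle p (S - W) (card W)))"
      by (rule F(2)) (use S in auto)
    also have "F ?S = (\<Sum>W\<in>Pow T. f (toggle p (?S - W) (card W)))"
    proof (rule F(2))
      show "?S \<subseteq> {..<N}" using S(1) assms(4) unfolding toggle_def by auto
      show "\<forall>t\<in>T. {t..<p} \<subseteq> ?S"
        using S(2) insert.hyps(2) unfolding toggle_def by (fastforce simp: subset_iff)
    qed
    also have "\<dots> = (\<Sum>W\<in>Pow T. f (toggle p (S - insert t W) (card (insert t W))))"
    proof (rule sum.cong[OF refl])
      fix W assume W: "W \<in> Pow T"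
      have "finite W" using W insert.hyps(1) by (auto intro: finite_subset)
      have "t \<notin> W" "p \<notin> W" using W tT insert.prems by auto
      then have "?S - W = toggle p (S - insert t W) 1"
        unfolding toggle_def using t by auto
      then show "f (toggle p (?S - W) (card W)) = f (toggle p (S - insert t W) (card (insert t W)))"
        using \<open>finite W\<close> \<open>t \<notin> W\<close> by (simp add: toggle_Suc)
    qed
    also have "\<dots> = (\<Sum>W\<in>insert t ` Pow T. f (toggle p (S - W) (card W)))"
      by (subst sum.reindex) (use tT in \<open>auto simp: inj_on_def\<close>)
    also have "(\<Sum>W\<in>Pow T. f (toggle p (S - W) (card W))) + \<dots> =
        (\<Sum>W\<in>Pow (insert t T). f (toggle p (S - W) (card W)))"
      unfolding Pow_insert by (rule sum.union_disjoint[symmetric]) (use tT insert.hyps in auto)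
    finally show "removal t p c c F S = (\<Sum>W\<in>Pow (insert t T). f (toggle p (S - W) (card W)))" .
  qed
qed

text \<open>In each term of the expansion \<open>p\<close> is either paired, with weight 0, or
  survives into a smaller Pfaffian.\<close>

lemma Pf_graph_isolated:
  assumes "finite S" "p \<in> S" "\<And>x. w {p, x} = 0"
  shows "Pf_graph w S = 0"
  using assms(1,2)
proof (induction "card S" arbitrary: S rule: less_induct)
  case less
  have S: "S \<noteq> {}" using less.prems by auto
  then have "Min S \<in> S" using less.prems by (intro Min_in)
  have "w {Min S, v} * Pf_graph w (S - {Min S, v}) = 0" if v: "v \<in> S" for v
  proof (cases "Min S = p \<or> v = p")
    case True
    then have "w {Min S, v} = 0" using assms(3) by (metis insert_commute)
    then show ?thesis by simp
  next
    case False
    have "card (S - {Min S, v}) < card S"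
      by (rule psubset_card_mono) (use less.prems \<open>Min S \<in> S\<close> in auto)
    then show ?thesis using less.hyps[of "S - {Min S, v}"] less.prems False by auto
  qed
  then show ?case
    unfolding Pf_graph_expand[OF less.prems(1) S] by (intro sum.neutral) (auto simp: mult.assoc)
qed

text \<open>For each \<open>W\<close>, exactly one of the toggled sets obtained from
  \<open>S\<close> and from \<open>insert p S\<close> lacks \<open>p\<close>. It contributes the
  Pfaffian of \<open>S - W\<close>; the other contains the isolated vertex \<open>p\<close> and
  contributes 0.\<close>

lemma realizable_PfS:
  fixes w :: "nat set \<Rightarrow> complex"
  assumes "T \<subseteq> {..<p}" "p < N" "\<And>x. w {p, x} = 0"
  shows "\<exists>F. realizable N F \<and> (\<forall>S\<subseteq>{..<N} - {p}. (\<forall>t\<in>T. {t..<p} \<subseteq> S) \<longrightarrow>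
    PfS w S T = F S + F (insert p S))"
proof -
  have finT: "finite T" by (rule finite_subset[OF assms(1)]) simp
  obtain F where F: "realizable N F" "\<And>S. S \<subseteq> {..<N} \<Longrightarrow> (\<forall>t\<in>T. {t..<p} \<subseteq> S) \<Longrightarrow>
    F S = (\<Sum>W\<in>Pow T. Pf_graph w (toggle p (S - W) (card W)))"
    using realizable_subset_sum[OF realizable_Pf_graph[of N w] finT assms(1,2)] by auto
  have "PfS w S T = F S + F (insert p S)" if S: "S \<subseteq> {..<N} - {p}" "\<forall>t\<in>T. {t..<p} \<subseteq> S" for S
  proof -
    have finS: "finite S" by (rule finite_subset[of _ "{..<N}"]) (use S in auto)
    have iso: "Pf_graph w (insert p S') = 0" if "S' \<subseteq> S" for S'
      by (rule Pf_graph_isolated[where p = p]) (use finite_subset[OF that finS] assms(3) in auto)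
    have "F S + F (insert p S) = (\<Sum>W\<in>Pow T. Pf_graph w (toggle p (S - W) (card W)) +
        Pf_graph w (toggle p (insert p S - W) (card W)))"
    proof -
      have "F S = (\<Sum>W\<in>Pow T. Pf_graph w (toggle p (S - W) (card W)))"
        by (rule F(2)) (use S in auto)
      moreover have "F (insert p S) = (\<Sum>W\<in>Pow T. Pf_graph w (toggle p (insert p S - W) (card W)))"
        by (rule F(2)) (use S assms in auto)
      ultimately show ?thesis by (simp add: sum.distrib)
    qed
    also have "\<dots> = (\<Sum>W\<in>Pow T. Pf_graph w (S - W))"
    proof (rule sum.cong[OF refl])
      fix W assume W: "W \<in> Pow T"
      then have p: "p \<notin> W" "p \<notin> S" using assms(1) S by auto
      then have 1: "insert p S - W = insert p (S - W)" by auto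
      have 2: "Pf_graph w (insert p (S - W)) = 0" by (rule iso) auto
      show "Pf_graph w (toggle p (S - W) (card W)) +
        Pf_graph w (toggle p (insert p S - W) (card W)) = Pf_graph w (S - W)"
        unfolding 1 toggle_def using p 2 by auto
    qed
    finally show ?thesis unfolding PfS_def by simp
  qed
  then show ?thesis using F(1) by blast
qed

section \<open>Drawings in the disk\<close>

text \<open>Polar coordinates with the height as radius and the horizontal coordinate as clockwise
  angle; height 1 is the boundary circle.\<close>

definition strip_to_disk :: "complex \<Rightarrow> complex" where
  "strip_to_disk z = of_real (Im z) * cis (- Re z)"

lemma norm_strip_to_disk: "norm (strip_to_disk z) = \<bar>Im z\<bar>"
  unfolding strip_to_disk_def by (simp add: norm_mult)

lemma inj_on_strip_to_disk: "inj_on strip_to_disk {z. 0 < Im z \<and> a \<le> Re z \<and> Re z < a + 2 * pi}"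
proof (rule inj_onI, clarify)
  fix z z' :: complex
  assume z: "0 < Im z" "a \<le> Re z" "Re z < a + 2 * pi" "0 < Im z'" "a \<le> Re z'" "Re z' < a + 2 * pi"
    and eq: "strip_to_disk z = strip_to_disk z'"
  have im: "Im z = Im z'" using arg_cong[OF eq, of norm] z by (simp add: norm_strip_to_disk)
  then have "cis (- Re z) = cis (- Re z')" using eq z unfolding strip_to_disk_def by simp
  then have "cos (Re z) = cos (Re z') \<and> sin (Re z) = sin (Re z')"
    by (simp add: complex_eq_iff)
  then obtain n :: int where n: "Re z = Re z' + 2 * pi * n" using sin_cos_eq_iff by blast
  have "2 * pi * n < 2 * pi * 1" "2 * pi * (- 1) < 2 * pi * n" using n z by linarith+
  then have "real_of_int n < 1" "- 1 < real_of_int n"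
    by (simp_all only: mult_less_cancel_left_pos[of "2 * pi"] pi_gt_zero zero_less_mult_iff zero_less_numeral simp_thms)
  then have "n = 0" by linarith
  then show "z = z'" using n im by (simp add: complex_eq_iff)
qed

text \<open>On a half-open strip of width \<open>2 * pi\<close> the wrapping map is continuous and
  injective, and the strip is convex, so disjointness of segments carries over to their images. Each
  edge must have an end of height below 1, since otherwise its whole arc would run along the
  circle.\<close>

lemma planar_disk_embedding_strip:
  fixes P :: "nat \<Rightarrow> complex"
  assumes inj: "inj_on P V"
    and strip: "\<And>v. v \<in> V \<Longrightarrow> 0 < Im (P v) \<and> Im (P v) \<le> 1 \<and> a \<le> Re (P v) \<and> Re (P v) < a + 2 * pi"
    and ext: "\<And>j. j < length ext \<Longrightarrow> P (ext ! j) = Complex (2 * pi * real j / real (length ext)) 1"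
    and int: "\<And>v. v \<in> V - set ext \<Longrightarrow> Im (P v) < 1"
    and edge: "\<And>e. w e \<noteq> 0 \<Longrightarrow> e \<subseteq> V \<and> (\<exists>v\<in>e. Im (P v) < 1)"
    and avoid: "\<And>e. w e \<noteq> 0 \<Longrightarrow> convex hull (P ` e) \<inter> P ` V \<subseteq> P ` e"
    and cross: "\<And>e e'. w e \<noteq> 0 \<Longrightarrow> w e' \<noteq> 0 \<Longrightarrow> e \<noteq> e' \<Longrightarrow>
      convex hull (P ` e) \<inter> convex hull (P ` e') \<subseteq> P ` (e \<inter> e')"
  shows "planar_disk_embedding V w ext"
proof -
  define D where "D = {z. 0 < Im z \<and> a \<le> Re z \<and> Re z < a + 2 * pi}"
  define p where "p v = strip_to_disk (P v)" for v
  define \<gamma> where "\<gamma> u v = strip_to_disk \<circ> linepath (P u) (P v)" for u v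
  have injD: "inj_on strip_to_disk D" unfolding D_def by (rule inj_on_strip_to_disk)
  have cont: "continuous_on S strip_to_disk" for S
    unfolding strip_to_disk_def by (intro continuous_intros)
  have PD: "P v \<in> D" if "v \<in> V" for v using strip[OF that] unfolding D_def by simp
  have convD: "convex D"
  proof -
    have "D = {z. 0 < Im z} \<inter> {z. a \<le> Re z} \<inter> {z. Re z < a + 2 * pi}" unfolding D_def by auto
    then show ?thesis
      by (simp add: convex_Int convex_halfspace_Im_gt convex_halfspace_Re_ge convex_halfspace_Re_lt)
  qed
  have seg: "closed_segment (P u) (P v) = convex hull (P ` {u, v})" for u v
    by (simp add: segment_convex_hull)
  have segD: "closed_segment (P u) (P v) \<subseteq> D" if "w {u, v} \<noteq> 0" for u v
    using edge[OF that] PD convD by (intro closed_segment_subset) auto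
  have img: "path_image (\<gamma> u v) = strip_to_disk ` (convex hull (P ` {u, v}))" for u v
    unfolding \<gamma>_def path_image_compose path_image_linepath seg ..
  have ne: "P u \<noteq> P v" if "w {u, v} \<noteq> 0" "u < v" for u v
    using edge[OF that(1)] inj that(2) by (auto dest: inj_onD)
  have "inj_on p V"
    unfolding p_def using comp_inj_on[OF inj inj_on_subset[OF injD]] PD by (auto simp: o_def)
  moreover have "p (ext ! j) = cis (- 2 * pi * real j / real (length ext))" if "j < length ext" for j
    unfolding p_def ext[OF that] strip_to_disk_def by simp
  moreover have "p v \<in> ball 0 1" if "v \<in> V - set ext" for v
    using int[OF that] strip[of v] that unfolding p_def by (simp add: norm_strip_to_disk)
  moreover have "arc (\<gamma> u v) \<and> pathstart (\<gamma> u v) = p u \<and> pathfinish (\<gamma> u v) = p v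
         \<and> (\<forall>t \<in> {0<..<1}. \<gamma> u v t \<in> ball 0 1 \<and> \<gamma> u v t \<notin> p ` V)"
    if uv: "u < v \<and> w {u, v} \<noteq> 0" for u v
  proof (intro conjI ballI)
    have l: "arc (linepath (P u) (P v))" using ne uv by (simp add: arc_linepath)
    show "arc (\<gamma> u v)"
      unfolding arc_def
    proof
      show "path (\<gamma> u v)" unfolding \<gamma>_def by (rule path_continuous_image) (auto intro: cont)
      show "inj_on (\<gamma> u v) {0..1}" unfolding \<gamma>_def
      proof (rule comp_inj_on)
        show "inj_on (linepath (P u) (P v)) {0..1}" using l unfolding arc_def by simp
        show "inj_on strip_to_disk (linepath (P u) (P v) ` {0..1})"
          by (rule inj_on_subset[OF injD]) (use segD uv in \<open>simp add: linepath_image_01\<close>)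
      qed
    qed
    show "pathstart (\<gamma> u v) = p u" "pathfinish (\<gamma> u v) = p v"
      unfolding \<gamma>_def p_def by (simp_all add: pathstart_compose pathfinish_compose)
    fix t :: real assume t: "t \<in> {0<..<1}"
    define z where "z = linepath (P u) (P v) t"
    have uvV: "u \<in> V" "v \<in> V" using edge uv by auto
    have zs: "z \<in> closed_segment (P u) (P v)"
      using t unfolding z_def by (auto simp: linepath_image_01[symmetric])
    then have zD: "z \<in> D" using segD uv by auto
    have "Im z = (1 - t) * Im (P u) + t * Im (P v)" unfolding z_def linepath_def by simp
    also have "\<dots> < 1"
    proof -
      have b: "Im (P u) \<le> 1" "Im (P v) \<le> 1" using strip uvV by auto
      have "Im (P u) < 1 \<or> Im (P v) < 1" using edge uv by auto
      then show ?thesis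
      proof
        assume "Im (P u) < 1"
        then have "(1 - t) * Im (P u) < 1 - t" "t * Im (P v) \<le> t"
          using t b mult_strict_left_mono[of "Im (P u)" 1 "1 - t"] by (auto simp: mult_left_le)
        then show ?thesis by linarith
      next
        assume "Im (P v) < 1"
        then have "(1 - t) * Im (P u) \<le> 1 - t" "t * Im (P v) < t"
          using t b mult_strict_left_mono[of "Im (P v)" 1 t] by (auto simp: mult_left_le)
        then show ?thesis by linarith
      qed
    qed
    finally show "\<gamma> u v t \<in> ball 0 1"
      using zD unfolding \<gamma>_def z_def[symmetric] D_def o_apply by (simp add: norm_strip_to_disk z_def[symmetric])
    show "\<gamma> u v t \<notin> p ` V"
    proof
      assume "\<gamma> u v t \<in> p ` V"
      then obtain x where x: "x \<in> V" "strip_to_disk z = strip_to_disk (P x)"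
        unfolding \<gamma>_def p_def z_def by auto
      then have "z = P x" using injD zD PD by (auto dest: inj_onD)
      then have "z \<in> P ` {u, v}" using avoid[of "{u, v}"] uv zs x unfolding seg by blast
      then have "z = linepath (P u) (P v) 0 \<or> z = linepath (P u) (P v) 1" by (auto simp: linepath_def)
      then show False
        using l t inj_onD[of "linepath (P u) (P v)" "{0..1}" t 0] inj_onD[of "linepath (P u) (P v)" "{0..1}" t 1]
        unfolding z_def arc_def by auto
    qed
  qed
  moreover have "path_image (\<gamma> u v) \<inter> path_image (\<gamma> u' v') \<subseteq> p ` ({u, v} \<inter> {u', v'})"
    if uv: "u < v \<and> w {u, v} \<noteq> 0 \<and> u' < v' \<and> w {u', v'} \<noteq> 0 \<and> (u, v) \<noteq> (u', v')" for u v u' v'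
  proof -
    have "{u, v} \<noteq> {u', v'}" using uv by (auto simp: doubleton_eq_iff)
    then have "convex hull (P ` {u, v}) \<inter> convex hull (P ` {u', v'}) \<subseteq> P ` ({u, v} \<inter> {u', v'})"
      using cross uv by blast
    then have "strip_to_disk ` (convex hull (P ` {u, v}) \<inter> convex hull (P ` {u', v'})) \<subseteq> p ` ({u, v} \<inter> {u', v'})"
      unfolding p_def by auto
    moreover have "convex hull (P ` {u, v}) \<subseteq> D" "convex hull (P ` {u', v'}) \<subseteq> D"
      using segD uv unfolding seg by auto
    ultimately show ?thesis unfolding img using inj_on_image_Int[OF injD] by simp
  qed
  ultimately show ?thesis unfolding planar_disk_embedding_def by blast
qed

lemma card_le_nth:
  fixes es :: "nat list"
  assumes "sorted_wrt (<) es" "j < length es"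
  shows "card {x\<in>set es. x \<le> es ! j} = j + 1"
proof -
  have "{x\<in>set es. x \<le> es ! j} = (!) es ` {..j}"
  proof
    show "{x\<in>set es. x \<le> es ! j} \<subseteq> (!) es ` {..j}"
    proof clarify
      fix x assume "x \<in> set es" "x \<le> es ! j"
      then obtain i where i: "i < length es" "x = es ! i" by (auto simp: in_set_conv_nth)
      have "i \<le> j" using sorted_wrt_nth_less[OF assms(1), of j i] i \<open>x \<le> es ! j\<close> by (meson leD le_less_linear)
      then show "x \<in> (!) es ` {..j}" using i by auto
    qed
    have "es ! i \<le> es ! j" if "i \<le> j" for i
      using sorted_wrt_nth_less[OF assms(1), of i j] that assms(2) by (cases "i = j") auto
    then show "(!) es ` {..j} \<subseteq> {x\<in>set es. x \<le> es ! j}" using assms(2) by auto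
  qed
  moreover have "inj_on ((!) es) {..j}"
    using assms by (intro inj_on_nth) (auto simp: strict_sorted_iff)
  ultimately show ?thesis by (simp add: card_image)
qed

text \<open>The angles of the external wires are prescribed, and all other wires have to be fitted
  in between, in order and within one full turn. In units of \<open>2 * pi / k\<close>, wire
  \<open>i\<close> is put at the position \<open>b i\<close> of the last external wire up to
  \<open>i\<close>, plus an offset \<open>s i\<close> below 1/2 that increases with \<open>i\<close>
  on the other wires.\<close>

lemma angle_assignment:
  assumes "sorted_wrt (<) es"
  obtains \<xi> :: "nat \<Rightarrow> real" and a :: real
  where "\<And>i j. i < j \<Longrightarrow> j < N \<Longrightarrow> \<xi> i < \<xi> j"
    and "\<And>i. i < N \<Longrightarrow> a \<le> \<xi> i \<and> \<xi> i < a + 2 * pi"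
    and "\<And>j. j < length es \<Longrightarrow> \<xi> (es ! j) = 2 * pi * real j / real (length es)"
proof -
  \<comment> \<open>The maximum with 1 keeps the divisor nonzero when there are no external
    nodes.\<close>
  define k :: real where "k = max (real (length es)) 1"
  define c where "c i = card {x\<in>set es. x \<le> i}" for i
  \<comment> \<open>Wires before the first external one share the arc between the last and the first external
    node with the wires after the last one; each group gets one half of it.\<close>
  define b where "b i = max (real (c i) - 1) (- (1 / 2))" for i
  define s where "s i = (if i \<in> set es then 0 else (real i + 1) / (2 * (real N + 1)))" for i
  have k: "k \<ge> 1" "k > 0" unfolding k_def by auto
  have ck: "real (c i) \<le> k" for i
  proof -
    have "c i \<le> card (set es)" unfolding c_def by (rule card_mono) auto
    also have "\<dots> \<le> length es" by (rule card_length)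
    finally show ?thesis unfolding k_def by simp
  qed
  have s: "0 \<le> s i" "s i < 1 / 2" if "i < N" for i
    using that unfolding s_def by (auto simp: field_simps)
  have b: "- (1 / 2) \<le> b i" "b i \<le> k - 1" for i
    using ck[of i] k unfolding b_def by auto
  have cmono: "c i \<le> c j" if "i \<le> j" for i j
    unfolding c_def by (rule card_mono) (use that in auto)
  have mono: "b i + s i < b j + s j" if "i < j" "j < N" for i j
  proof (cases "c i = c j")
    case True
    have "j \<notin> set es"
    proof
      assume "j \<in> set es"
      then have "j \<in> {x\<in>set es. x \<le> j}" "j \<notin> {x\<in>set es. x \<le> i}" using that by simp_all
      moreover have "{x\<in>set es. x \<le> i} \<subseteq> {x\<in>set es. x \<le> j}" using that by auto
      ultimately have "{x\<in>set es. x \<le> i} \<subset> {x\<in>set es. x \<le> j}" by blast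
      then have "c i < c j" unfolding c_def by (intro psubset_card_mono) auto
      then show False using True by simp
    qed
    then have "s i < s j" using that unfolding s_def by (auto simp: divide_strict_right_mono)
    then show ?thesis using True unfolding b_def by simp
  next
    case False
    then have "c i + 1 \<le> c j" using cmono[of i j] that by simp
    then have "b i + 1 / 2 \<le> b j" unfolding b_def by (auto simp: max_def)
    then show ?thesis using s[of i] s[of j] that by linarith
  qed
  have kp: "0 < 2 * pi / k" using k by simp
  show thesis
  proof (rule that[of "\<lambda>i. 2 * pi / k * (b i + s i)" "2 * pi / k * (- (1 / 2))"])
    show "2 * pi / k * (b i + s i) < 2 * pi / k * (b j + s j)" if "i < j" "j < N" for i j
      using mono[OF that] kp by (rule mult_strict_left_mono)
    fix i assume i: "i < N"
    have "2 * pi / k * (- (1 / 2)) \<le> 2 * pi / k * (b i + s i)"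
      using b[of i] s[OF i] kp by (intro mult_left_mono) auto
    moreover have "2 * pi / k * (b i + s i) < 2 * pi / k * (k - 1 / 2)"
      using b[of i] s[OF i] kp by (intro mult_strict_left_mono) auto
    moreover have "2 * pi / k * (k - 1 / 2) = 2 * pi / k * (- (1 / 2)) + 2 * pi"
      using k by (simp add: field_simps)
    ultimately show "2 * pi / k * (- (1 / 2)) \<le> 2 * pi / k * (b i + s i) \<and>
        2 * pi / k * (b i + s i) < 2 * pi / k * (- (1 / 2)) + 2 * pi" by simp
  next
    fix j assume j: "j < length es"
    have "c (es ! j) = j + 1" unfolding c_def by (rule card_le_nth[OF assms j])
    then have "b (es ! j) + s (es ! j) = real j" using j unfolding b_def s_def by simp
    then show "2 * pi / k * (b (es ! j) + s (es ! j)) = 2 * pi * real j / real (length es)"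
      using j unfolding k_def by simp
  qed
qed

section \<open>Planarity of the grid\<close>

text \<open>The reversal is due to the rows being counted from the bottom, whereas the list of gates
  starts at the top: gate \<open>s\<close> from below joins wires within the rows
  \<open>2 * s + 1\<close> and \<open>2 * s + 2\<close>.\<close>

lemma grid_weight_edge:
  assumes "grid_weight N gs e \<noteq> 0"
  obtains (vertical) x r where "x < N" "r < 2 * length gs" "e = {(x, r), (x, r + 1)}"
    | (gate) s i j d c where "s < length gs" "rev gs ! s = (i, j, d, c)" "c \<noteq> 0"
        "e = {(i, 2 * s + 2), (j, 2 * s + 2 - d)}"
proof -
  have "(\<exists>x r. x < N \<and> r < 2 * length gs \<and> e = {(x, r), (x, r + 1)}) \<or>
    (\<exists>s i j d c. s < length gs \<and> rev gs ! s = (i, j, d, c) \<and> c \<noteq> 0 \<and>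
      e = {(i, 2 * s + 2), (j, 2 * s + 2 - d)})" (is "?V (length gs) \<or> ?G gs")
    using assms
  proof (induction gs)
    case (Cons g gs)
    obtain i j d c where g: "g = (i, j, d, c)" by (rule prod_cases4)
    define s where "s = 2 * length gs"
    have "grid_weight N (g # gs) e \<noteq> 0" by fact
    then consider "e = {(i, s + 2), (j, s + 2 - d)}" "c \<noteq> 0"
      | x where "x < N" "e = {(x, s), (x, s + 1)} \<or> e = {(x, s + 1), (x, s + 1 + 1)}"
      | "grid_weight N gs e \<noteq> 0"
      unfolding g s_def by (auto simp: Let_def split: if_splits)
    then show ?case
    proof cases
      case 1
      then have "?G (g # gs)"
        by (intro exI[of _ "length gs"] exI[of _ i] exI[of _ j] exI[of _ d] exI[of _ c])
          (simp add: g s_def nth_append)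
      then show ?thesis ..
    next
      case 2
      have "s < 2 * length (g # gs)" "s + 1 < 2 * length (g # gs)" unfolding s_def by auto
      then have "?V (length (g # gs))" using 2 by blast
      then show ?thesis ..
    next
      case 3
      then consider "?V (length gs)" | "?G gs" using Cons.IH by blast
      then show ?thesis
      proof cases
        case 1
        then obtain x r where "x < N" "r < 2 * length gs" "e = {(x, r), (x, r + 1)}" by blast
        then have "?V (length (g # gs))" by (intro exI[of _ x] exI[of _ r]) simp
        then show ?thesis ..
      next
        case 2
        then obtain s i j d c where *: "s < length gs" "rev gs ! s = (i, j, d, c)" "c \<noteq> 0"
          "e = {(i, 2 * s + 2), (j, 2 * s + 2 - d)}" by blast
        then have "?G (g # gs)"
          by (intro exI[of _ s] exI[of _ i] exI[of _ j] exI[of _ d] exI[of _ c])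
            (simp add: nth_append)
        then show ?thesis ..
      qed
    qed
  qed simp
  then show thesis by (elim disjE exE conjE) (rule vertical gate; assumption)+
qed

lemma closed_segment_Im:
  assumes "z \<in> closed_segment p q" "Im p \<le> Im q"
  shows "Im p \<le> Im z" "Im z \<le> Im q"
proof -
  obtain u where u: "0 \<le> u" "u \<le> 1" "z = (1 - u) *\<^sub>R p + u *\<^sub>R q"
    using assms(1) unfolding in_segment by auto
  have z: "Im z = Im p + u * (Im q - Im p)" unfolding u(3) by (simp add: algebra_simps)
  have "0 \<le> u * (Im q - Im p)" "u * (Im q - Im p) \<le> 1 * (Im q - Im p)"
    using u assms(2) mult_right_mono[of u 1 "Im q - Im p"] by auto
  then show "Im p \<le> Im z" "Im z \<le> Im q" unfolding z by auto
qed

lemma closed_segment_Re_strict: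
  assumes "z \<in> closed_segment p q" "Re p < Re q"
  shows "z = p \<or> z = q \<or> Re p < Re z \<and> Re z < Re q"
proof -
  obtain u where u: "0 \<le> u" "u \<le> 1" "z = (1 - u) *\<^sub>R p + u *\<^sub>R q"
    using assms(1) unfolding in_segment by auto
  have z: "Re z = Re p + u * (Re q - Re p)" unfolding u(3) by (simp add: algebra_simps)
  consider "u = 0" | "u = 1" | "0 < u" "u < 1" using u by linarith
  then show ?thesis
  proof cases
    case 3
    then have "0 < u * (Re q - Re p)" "u * (Re q - Re p) < 1 * (Re q - Re p)"
      using assms(2) by (auto intro!: mult_pos_pos mult_strict_right_mono)
    then show ?thesis unfolding z by auto
  qed (use u(3) in auto)
qed

text \<open>Heights depend on the wire because the top row is uneven: its external nodes are raised
  to the circle. \<open>y_gate\<close> makes the rows level up to every gate of nonzero weight, so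
  that gate edges stay in horizontal bands.\<close>

locale grid_drawing =
  fixes N :: nat and gs :: "gate list" and \<xi> :: "nat \<Rightarrow> real" and y :: "nat \<Rightarrow> nat \<Rightarrow> real"
    and \<eta> :: "nat \<Rightarrow> real"
  assumes valid: "list_all (valid_gate N) gs"
    and \<xi>_mono: "\<And>i j. i < j \<Longrightarrow> j < N \<Longrightarrow> \<xi> i < \<xi> j"
    and y_mono: "\<And>i r r'. r < r' \<Longrightarrow> r' \<le> 2 * length gs \<Longrightarrow> y i r < y i r'"
    and y_gate: "\<And>i j d c r s x. s < length gs \<Longrightarrow> rev gs ! s = (i, j, d, c) \<Longrightarrow> c \<noteq> 0 \<Longrightarrow>
      r \<le> 2 * s + 2 \<Longrightarrow> y x r = \<eta> r"
begin

definition point :: "nat \<times> nat \<Rightarrow> complex" where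
  "point v = Complex (\<xi> (fst v)) (y (fst v) (snd v))"

lemma \<xi>_inj: "i < N \<Longrightarrow> j < N \<Longrightarrow> \<xi> i = \<xi> j \<Longrightarrow> i = j"
  using \<xi>_mono by (metis less_irrefl linorder_neqE_nat)

lemma y_le_iff: "r \<le> 2 * length gs \<Longrightarrow> r' \<le> 2 * length gs \<Longrightarrow> y i r \<le> y i r' \<longleftrightarrow> r \<le> r'"
  using y_mono by (metis le_less_linear le_neq_implies_less less_le_not_le order_refl)

lemma point_inj:
  assumes "u \<in> {..<N} \<times> {..2 * length gs}" "v \<in> {..<N} \<times> {..2 * length gs}" "point u = point v"
  shows "u = v"
proof -
  have "fst u = fst v" using \<xi>_inj assms unfolding point_def by auto
  moreover have "snd u = snd v"
    using assms calculation y_le_iff[of "snd u" "snd v" "fst u"] y_le_iff[of "snd v" "snd u" "fst u"]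
    unfolding point_def by (auto intro: antisym)
  ultimately show ?thesis by (simp add: prod_eq_iff)
qed

lemma vertical_hull:
  assumes "z \<in> convex hull (point ` {(x, r), (x, r + 1)})" "r < 2 * length gs"
  shows "Re z = \<xi> x" "y x r \<le> Im z" "Im z \<le> y x (r + 1)"
proof -
  have z: "z \<in> closed_segment (point (x, r)) (point (x, r + 1))"
    using assms(1) by (simp add: segment_convex_hull)
  have "y x r < y x (r + 1)" by (rule y_mono) (use assms in auto)
  then show "y x r \<le> Im z" "Im z \<le> y x (r + 1)"
    using closed_segment_Im[OF z] by (auto simp: point_def)
  show "Re z = \<xi> x"
  proof -
    obtain u where "z = (1 - u) *\<^sub>R point (x, r) + u *\<^sub>R point (x, r + 1)"
      using z unfolding in_segment by auto
    then have "Re z = (1 - u) * \<xi> x + u * \<xi> x" by (simp add: point_def)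
    then show ?thesis by (simp add: algebra_simps)
  qed
qed

lemma gate_indices:
  assumes "s < length gs" "rev gs ! s = (i, j, d, c)"
  shows "i < N" "j < N" "j = Suc i \<or> i = Suc j" "d \<le> 1"
proof -
  have "(i, j, d, c) \<in> set gs" using assms by (metis length_rev nth_mem set_rev)
  then show "i < N" "j < N" "j = Suc i \<or> i = Suc j" "d \<le> 1"
    using valid by (auto simp: list_all_iff)
qed

text \<open>A gate joins neighbouring wires, so no wire runs strictly between its ends; and as the
  rows are level there, the segment stays in the band of its own two rows.\<close>

lemma gate_hull:
  assumes "z \<in> convex hull (point ` {(i, 2 * s + 2), (j, 2 * s + 2 - d)})"
    "s < length gs" "rev gs ! s = (i, j, d, c)" "c \<noteq> 0"
  shows "(z \<in> point ` {(i, 2 * s + 2), (j, 2 * s + 2 - d)} \<or> (\<forall>x<N. Re z \<noteq> \<xi> x)) \<and>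
    \<eta> (2 * s + 1) \<le> Im z \<and> Im z \<le> \<eta> (2 * s + 2)"
proof -
  let ?p = "point (i, 2 * s + 2)" and ?q = "point (j, 2 * s + 2 - d)"
  note ij = gate_indices[OF assms(2,3)]
  have z: "z \<in> closed_segment ?p ?q" "z \<in> closed_segment ?q ?p"
    using assms(1) by (simp_all add: segment_convex_hull insert_commute)
  have \<eta>: "y x r = \<eta> r" if "r \<le> 2 * s + 2" for x r
    using y_gate[OF assms(2-4) that] .
  have "\<eta> (2 * s + 1) < \<eta> (2 * s + 2)"
    using y_mono[of "2 * s + 1" "2 * s + 2" i] assms(2) by (simp add: \<eta>)
  moreover have "Im ?p = \<eta> (2 * s + 2)" "Im ?q = \<eta> (2 * s + 2 - d)" by (simp_all add: point_def \<eta>)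
  moreover have "d = 0 \<or> d = 1" using ij by auto
  ultimately have "\<eta> (2 * s + 1) \<le> Im z \<and> Im z \<le> \<eta> (2 * s + 2)"
    using closed_segment_Im[OF z(2)] by auto
  moreover have "z = ?p \<or> z = ?q \<or> (\<forall>x<N. Re z \<noteq> \<xi> x)"
  proof -
    have between: "\<xi> x \<le> \<xi> a \<or> \<xi> (Suc a) \<le> \<xi> x" if "x < N" "Suc a < N" for x a
      using \<xi>_mono[of x a] \<xi>_mono[of "Suc a" x] that
      by (metis Suc_lessD le_less_linear less_imp_le not_less_eq order_refl le_neq_implies_less)
    show ?thesis
    proof (cases "j = Suc i")
      case True
      then have "Re ?p < Re ?q" using \<xi>_mono[of i j] ij by (simp add: point_def)
      then show ?thesis
        using closed_segment_Re_strict[OF z(1)] between[of _ i] True ij by (force simp: point_def)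
    next
      case False
      then have i: "i = Suc j" using ij by simp
      then have "Re ?q < Re ?p" using \<xi>_mono[of j i] ij by (simp add: point_def)
      then show ?thesis
        using closed_segment_Re_strict[OF z(2)] between[of _ j] i ij by (force simp: point_def)
    qed
  qed
  ultimately show ?thesis by auto
qed

lemma hull_avoids_points:
  assumes "grid_weight N gs e \<noteq> 0"
  shows "convex hull (point ` e) \<inter> point ` ({..<N} \<times> {..2 * length gs}) \<subseteq> point ` e"
proof clarify
  fix x r assume z: "point (x, r) \<in> convex hull (point ` e)" and x: "x < N" "r \<le> 2 * length gs"
  from assms show "point (x, r) \<in> point ` e"
  proof (cases rule: grid_weight_edge)
    case (vertical x' r')
    note h = vertical_hull[OF z[unfolded vertical(3)] vertical(2)]
    have "x = x'" using h(1) \<xi>_inj x vertical(1) by (simp add: point_def)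
    then have "r' \<le> r" "r \<le> r' + 1"
      using h(2,3) y_le_iff[of r' r x] y_le_iff[of r "r' + 1" x] vertical(2) x
      by (auto simp: point_def)
    then have "r = r' \<or> r = r' + 1" by auto
    then show ?thesis using \<open>x = x'\<close> unfolding vertical(3) by auto
  next
    case (gate s i j d c)
    have "Re (point (x, r)) = \<xi> x" by (simp add: point_def)
    then show ?thesis
      using gate_hull[OF z[unfolded gate(4)] gate(1-3)] x(1) unfolding gate(4) by blast
  qed
qed

text \<open>A common point lies on a wire, so it is an end of the gate edge; being a vertex on the
  vertical edge, it is also an end of that edge.\<close>

lemma vertical_gate_cross:
  assumes "x < N" "r < 2 * length gs" "e = {(x, r), (x, r + 1)}"
    and "grid_weight N gs e \<noteq> 0"
    and "s < length gs" "rev gs ! s = (i, j, d, c)" "c \<noteq> 0"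
      "e' = {(i, 2 * s + 2), (j, 2 * s + 2 - d)}"
  shows "convex hull (point ` e) \<inter> convex hull (point ` e') \<subseteq> point ` (e \<inter> e')"
proof clarify
  fix z assume z: "z \<in> convex hull (point ` e)" "z \<in> convex hull (point ` e')"
  have "Re z = \<xi> x" by (rule vertical_hull(1)[OF z(1)[unfolded assms(3)] assms(2)])
  then have "z \<in> point ` e'"
    using gate_hull[OF z(2)[unfolded assms(8)] assms(5-7)] assms(1) unfolding assms(8) by blast
  then obtain v where v: "v \<in> e'" "z = point v" by auto
  have vg: "v \<in> {..<N} \<times> {..2 * length gs}"
    using v(1) gate_indices[OF assms(5,6)] assms(5) unfolding assms(8) by auto
  then have "z \<in> point ` e" using hull_avoids_points[OF assms(4)] z(1) v(2) by blast
  then obtain u where u: "u \<in> e" "z = point u" by auto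
  have "u \<in> {..<N} \<times> {..2 * length gs}" using u(1) assms(1,2) unfolding assms(3) by auto
  then have "u = v" using point_inj vg u v by auto
  then show "z \<in> point ` (e \<inter> e')" using u v by auto
qed

lemma hulls_cross:
  assumes w: "grid_weight N gs e \<noteq> 0" "grid_weight N gs e' \<noteq> 0" and ne: "e \<noteq> e'"
  shows "convex hull (point ` e) \<inter> convex hull (point ` e') \<subseteq> point ` (e \<inter> e')"
  using w(1)
proof (cases rule: grid_weight_edge)
  case v: (vertical x r)
  from w(2) show ?thesis
  proof (cases rule: grid_weight_edge)
    case v': (vertical x' r')
    show ?thesis
    proof clarify
      fix z assume z: "z \<in> convex hull (point ` e)" "z \<in> convex hull (point ` e')"
      note h = vertical_hull[OF z(1)[unfolded v(3)] v(2)]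
      note h' = vertical_hull[OF z(2)[unfolded v'(3)] v'(2)]
      have x: "x = x'" using h(1) h'(1) \<xi>_inj v(1) v'(1) by simp
      then have "y x r \<le> y x (r' + 1)" "y x r' \<le> y x (r + 1)" using h h' by auto
      then have "r \<le> r' + 1" "r' \<le> r + 1"
        using y_le_iff[of r "r' + 1" x] y_le_iff[of r' "r + 1" x] v(2) v'(2) by auto
      moreover have "r \<noteq> r'" using ne x v(3) v'(3) by auto
      ultimately consider "r' = r + 1" | "r = r' + 1" by linarith
      then show "z \<in> point ` (e \<inter> e')"
      proof cases
        case 1
        then have "z = point (x, r')" using h h' x by (simp add: point_def complex_eq_iff)
        then show ?thesis using 1 x unfolding v(3) v'(3) by auto
      next
        case 2
        then have "z = point (x, r)" using h h' x by (simp add: point_def complex_eq_iff)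
        then show ?thesis using 2 x unfolding v(3) v'(3) by auto
      qed
    qed
  next
    case (gate s i j d c)
    show ?thesis by (rule vertical_gate_cross[OF v w(1) gate])
  qed
next
  case g: (gate s i j d c)
  from w(2) show ?thesis
  proof (cases rule: grid_weight_edge)
    case (vertical x r)
    have "convex hull (point ` e') \<inter> convex hull (point ` e) \<subseteq> point ` (e' \<inter> e)"
      by (rule vertical_gate_cross[OF vertical w(2) g])
    then show ?thesis by (simp only: Int_commute)
  next
    case g': (gate s' i' j' d' c')
    have "s \<noteq> s'" using g g' ne by auto
    \<comment> \<open>The bands of different gates are disjoint.\<close>
    have disj: "\<eta> (2 * a + 2) < \<eta> (2 * b + 1)"
      if "a < b" "b < length gs" "rev gs ! b = (i, j, d, c)" "c \<noteq> 0" for a b i j d c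
    proof -
      have "y 0 (2 * a + 2) < y 0 (2 * b + 1)" by (rule y_mono) (use that in auto)
      then show ?thesis using y_gate[OF that(2-4)] that(1) by simp
    qed
    have False if z: "z \<in> convex hull (point ` e)" "z \<in> convex hull (point ` e')" for z
      using gate_hull[OF z(1)[unfolded g(4)] g(1-3)] gate_hull[OF z(2)[unfolded g'(4)] g'(1-3)]
        disj[OF _ g(1-3), of s'] disj[OF _ g'(1-3), of s] \<open>s \<noteq> s'\<close>
      by (cases "s < s'") auto
    then show ?thesis by blast
  qed
qed

end

section \<open>Planar matchgates of naked characters\<close>

text \<open>The gate of weight 0 on top separates the external nodes, which lie on the circle, from all
  edges joining different wires.\<close>
lemma grid_planar_matchgate:
  assumes gs: "list_all (valid_gate N) gs" and N: "2 \<le> N"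
    and es: "sorted_wrt (<) es" "set es \<subseteq> S" "S \<subseteq> {..<N}"
  defines "gs' \<equiv> (0, 1, 0, 0) # gs"
  defines "V \<equiv> prod_encode ` grid_vertices N gs' S"
  shows "planar_matchgate V (\<lambda>e. if e \<subseteq> V then grid_weight N gs' (prod_encode -` e) else 0)
    (map (\<lambda>i. prod_encode (i, 2 * length gs')) es)" (is "planar_matchgate V ?w ?ext")
proof -
  define R where "R = 2 * length gs'"
  have R2: "R = 2 * length gs + 2" unfolding R_def gs'_def by simp
  have valid: "list_all (valid_gate N) gs'" using gs N unfolding gs'_def by simp
  obtain \<xi> a where \<xi>: "\<And>i j. i < j \<Longrightarrow> j < N \<Longrightarrow> \<xi> i < \<xi> j"
    "\<And>i. i < N \<Longrightarrow> a \<le> \<xi> i \<and> \<xi> i < a + 2 * pi"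
    "\<And>j. j < length es \<Longrightarrow> \<xi> (es ! j) = 2 * pi * real j / real (length es)"
    using angle_assignment[OF es(1), of N] by metis
  \<comment> \<open>All these heights lie strictly between 0 and 1: the center of the disk is
    avoided, and only the raised external nodes reach the circle.\<close>
  define \<eta> where "\<eta> r = (real r + 1) / (real R + 2)" for r
  define y where "y i r = (if r = R \<and> i \<in> set es then 1 else \<eta> r)" for i r
  have \<eta>: "\<eta> r < \<eta> r'" if "r < r'" for r r' using that unfolding \<eta>_def by (simp add: divide_strict_right_mono)
  have \<eta>1: "0 < \<eta> r" "r \<le> R \<Longrightarrow> \<eta> r < 1" for r unfolding \<eta>_def by (auto simp: field_simps)
  interpret grid_drawing N gs' \<xi> y \<eta>
  proof
    show "list_all (valid_gate N) gs'" by (rule valid)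
    show "\<xi> i < \<xi> j" if "i < j" "j < N" for i j using \<xi>(1) that .
    show "y i r < y i r'" if "r < r'" "r' \<le> 2 * length gs'" for i r r'
      using \<eta>[OF that(1)] \<eta>1(2)[of r] that unfolding y_def R_def by auto
    fix i j d c r s x
    assume *: "s < length gs'" "rev gs' ! s = (i, j, d, c)" "c \<noteq> 0" "r \<le> 2 * s + 2"
    have "s \<noteq> length gs"
    proof
      assume "s = length gs"
      then have "rev gs' ! s = (0, 1, 0, 0)" unfolding gs'_def by (simp add: nth_append)
      then show False using * by simp
    qed
    then have "r \<noteq> R" using * unfolding gs'_def R2 by simp
    then show "y x r = \<eta> r" unfolding y_def by simp
  qed
  define P where "P v = point (prod_decode v)" for v
  have dec: "P ` prod_encode ` A = point ` A" for A unfolding P_def by (simp add: image_image)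
  have GV: "grid_vertices N gs' S \<subseteq> {..<N} \<times> {..R}"
    using es unfolding grid_vertices_def R_def by auto
  have fin: "finite V" unfolding V_def using finite_subset[OF GV] by simp
  have enc_vimage: "prod_encode ` (prod_encode -` e) = e" for e
    by (simp add: surj_image_vimage_eq surj_prod_encode)
  have edge: "e \<subseteq> V" "grid_weight N gs' (prod_encode -` e) \<noteq> 0" if "?w e \<noteq> 0" for e
    using that by (auto split: if_splits)
  have cardv: "card (prod_encode -` e) = card e" for e
    using card_image[OF inj_on_subset[OF inj_prod_encode[of UNIV]], of "prod_encode -` e"] enc_vimage by simp
  have hull: "P ` e = point ` (prod_encode -` e)" for e
    using dec[of "prod_encode -` e"] enc_vimage by simp
  have PV: "P ` V \<subseteq> point ` ({..<N} \<times> {..2 * length gs'})"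
    unfolding V_def dec using GV unfolding R_def by auto
  have "planar_disk_embedding V ?w ?ext"
  proof (rule planar_disk_embedding_strip[where P = P and a = a])
    show "inj_on P V"
      unfolding V_def
    proof (rule inj_onI)
      fix u v assume "u \<in> prod_encode ` grid_vertices N gs' S" "v \<in> prod_encode ` grid_vertices N gs' S" "P u = P v"
      then obtain u' v' where "u = prod_encode u'" "v = prod_encode v'" "u' \<in> grid_vertices N gs' S"
        "v' \<in> grid_vertices N gs' S" by auto
      moreover have "u' = v'"
        using calculation \<open>P u = P v\<close> GV unfolding R_def by (intro point_inj) (auto simp: P_def)
      ultimately show "u = v" by simp
    qed
    fix v assume "v \<in> V"
    then obtain i r where v: "v = prod_encode (i, r)" "(i, r) \<in> grid_vertices N gs' S" unfolding V_def by auto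
    then have ir: "i < N" "r \<le> R" using GV by auto
    show "0 < Im (P v) \<and> Im (P v) \<le> 1 \<and> a \<le> Re (P v) \<and> Re (P v) < a + 2 * pi"
      using \<xi>(2)[OF ir(1)] \<eta>1(1)[of r] \<eta>1(2)[OF ir(2)] unfolding P_def v point_def y_def by auto
  next
    fix j assume "j < length ?ext"
    then show "P (?ext ! j) = Complex (2 * pi * real j / real (length ?ext)) 1"
      using \<xi>(3)[of j] unfolding P_def point_def y_def R_def by simp
  next
    fix v assume *: "v \<in> V - set ?ext"
    then obtain i r where v: "v = prod_encode (i, r)" "(i, r) \<in> grid_vertices N gs' S" unfolding V_def by auto
    then have "r \<le> R" using GV by auto
    moreover have "\<not> (r = R \<and> i \<in> set es)" using * unfolding v R_def by auto
    ultimately show "Im (P v) < 1" using \<eta>1(2)[of r] unfolding P_def v point_def y_def by simp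
  next
    fix e assume e: "?w e \<noteq> 0"
    have "\<exists>v\<in>prod_encode -` e. Im (point v) < 1"
      using edge(2)[OF e]
    proof (cases rule: grid_weight_edge)
      case (vertical x r)
      have "y x r < 1" using vertical(2) \<eta>1(2)[of r] unfolding y_def R_def by auto
      then show ?thesis unfolding vertical(3) by (simp add: point_def)
    next
      case (gate s i j d c)
      have "y i (2 * s + 2) = \<eta> (2 * s + 2)" by (rule y_gate[OF gate(1-3)]) simp
      then have "y i (2 * s + 2) < 1" using \<eta>1(2)[of "2 * s + 2"] gate(1) unfolding R_def by auto
      then show ?thesis unfolding gate(4) by (simp add: point_def)
    qed
    then show "e \<subseteq> V \<and> (\<exists>v\<in>e. Im (P v) < 1)"
      using edge(1)[OF e] unfolding P_def by (metis prod_encode_inverse vimageE)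
    show "convex hull (P ` e) \<inter> P ` V \<subseteq> P ` e"
      unfolding hull[of e] using hull_avoids_points[OF edge(2)[OF e]] PV by blast
  next
    fix e e' assume e: "?w e \<noteq> 0" "?w e' \<noteq> 0" "e \<noteq> e'"
    have "prod_encode -` e \<noteq> prod_encode -` e'"
    proof
      assume "prod_encode -` e = prod_encode -` e'"
      then have "prod_encode ` (prod_encode -` e) = prod_encode ` (prod_encode -` e')" by (simp only:)
      then show False using e(3) unfolding enc_vimage by contradiction
    qed
    then show "convex hull (P ` e) \<inter> convex hull (P ` e') \<subseteq> P ` (e \<inter> e')"
      unfolding hull vimage_Int by (rule hulls_cross[OF edge(2)[OF e(1)] edge(2)[OF e(2)]])
  qed
  moreover have "distinct ?ext"
    using es(1) by (auto simp: distinct_map strict_sorted_iff inj_on_def)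
  moreover have "set ?ext \<subseteq> V"
    using es(2) unfolding V_def grid_vertices_def by auto
  moreover have "e \<subseteq> V \<and> card e = 2" if "?w e \<noteq> 0" for e
    using grid_weight_rows[OF edge(2)[OF that] valid] edge(1)[OF that] cardv by simp
  ultimately show ?thesis using fin unfolding planar_matchgate_def by blast
qed

text \<open>Evaluating a signature deletes external nodes, and a circuit receives its input by the
  deletion of top vertices; with the external nodes in the top row the two coincide.\<close>

lemma realizable_planar:
  assumes "realizable N F" "2 \<le> N" "sorted_wrt (<) es" "set es \<subseteq> S" "S \<subseteq> {..<N}"
  shows "\<exists>V w ext. planar_matchgate V w ext \<and> length ext = length es \<and>
    (\<forall>\<alpha>. length \<alpha> = length es \<longrightarrow>
      signature V w ext \<alpha> = F (S - {es ! i | i. i < length \<alpha> \<and> \<alpha> ! i}))"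
proof -
  obtain gs where gs: "list_all (valid_gate N) gs" "\<And>S. S \<subseteq> {..<N} \<Longrightarrow> circuit_sem gs S = F S"
    using assms(1) unfolding realizable_def by auto
  define gs' where "gs' = (0, 1, 0, 0) # gs"
  have valid: "list_all (valid_gate N) gs'" using gs assms(2) unfolding gs'_def by simp
  define V where "V = prod_encode ` grid_vertices N gs' S"
  \<comment> \<open>\<open>grid_weight\<close> also gives weight to edges at top vertices of wires
    outside \<open>S\<close>, which are not vertices of this graph.\<close>
  define w where "w e = (if e \<subseteq> V then grid_weight N gs' (prod_encode -` e) else 0)" for e
  define ext where "ext = map (\<lambda>i. prod_encode (i, 2 * length gs')) es"
  have "planar_matchgate V w ext"
    using grid_planar_matchgate[OF gs(1) assms(2-5)] unfolding V_def w_def ext_def gs'_def by simp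
  moreover have "signature V w ext \<alpha> = F (S - {es ! i | i. i < length \<alpha> \<and> \<alpha> ! i})" (is "_ = F (S - ?Z)")
    if "length \<alpha> = length es" for \<alpha>
  proof -
    have "{ext ! i | i. i < length ext \<and> i < length \<alpha> \<and> \<alpha> ! i} = prod_encode ` (?Z \<times> {2 * length gs'})"
      using that unfolding ext_def by force
    moreover have "grid_vertices N gs' S - ?Z \<times> {2 * length gs'} = grid_vertices N gs' (S - ?Z)"
      unfolding grid_vertices_def by auto
    ultimately have V': "V - {ext ! i | i. i < length ext \<and> i < length \<alpha> \<and> \<alpha> ! i} =
        prod_encode ` grid_vertices N gs' (S - ?Z)"
      unfolding V_def by (simp only: image_set_diff[OF inj_prod_encode, symmetric])
    have sub: "prod_encode ` grid_vertices N gs' (S - ?Z) \<subseteq> V"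
      unfolding V_def grid_vertices_def by auto
    have "signature V w ext \<alpha> = PerfMatch w (prod_encode ` grid_vertices N gs' (S - ?Z))"
      unfolding signature_def V' ..
    also have "\<dots> = PerfMatch (\<lambda>e. grid_weight N gs' (prod_encode -` e)) (prod_encode ` grid_vertices N gs' (S - ?Z))"
      by (rule PerfMatch_cong) (use sub in \<open>auto simp: w_def\<close>)
    also have "\<dots> = PerfMatch (grid_weight N gs') (grid_vertices N gs' (S - ?Z))"
      by (rule PerfMatch_image[OF inj_prod_encode])
    also have "\<dots> = circuit_sem gs' (S - ?Z)"
      by (rule PerfMatch_grid[OF valid]) (use assms(5) in auto)
    also have "\<dots> = circuit_sem gs (S - ?Z)" unfolding gs'_def by simp
    also have "\<dots> = F (S - ?Z)" by (rule gs(2)) (use assms(5) in auto)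
    finally show ?thesis .
  qed
  ultimately show ?thesis by (intro exI[of _ V] exI[of _ w] exI[of _ ext]) (simp add: ext_def)
qed

section \<open>Relabelling the vertices by wires\<close>

lemma sorted_list_of_set_image_strict_mono:
  assumes "finite S" "strict_mono_on S h"
  shows "sorted_list_of_set (h ` S) = map h (sorted_list_of_set S)"
proof -
  have "sorted_wrt (<) (map h (sorted_list_of_set S))"
    unfolding sorted_wrt_map
    by (rule sorted_wrt_mono_rel[of _ "(<)"]) (use assms in \<open>auto simp: strict_mono_on_def\<close>)
  then show ?thesis
    using assms(1) by (metis finite_imageI list.set_map set_sorted_list_of_set
      sorted_list_of_set.idem_if_sorted_distinct strict_sorted_iff)
qed

lemma Pf_graph_image:
  assumes "finite S" "strict_mono_on S h" "\<And>a b. a \<in> S \<Longrightarrow> b \<in> S \<Longrightarrow> w' {h a, h b} = w {a, b}"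
  shows "Pf_graph w' (h ` S) = Pf_graph w S"
proof -
  have c: "card (h ` S) = card S"
    by (rule card_image) (rule strict_mono_on_imp_inj_on[OF assms(2)])
  define s where "s = sorted_list_of_set S"
  have s: "set s = S" "length s = card S" using assms(1) by (auto simp: s_def)
  show ?thesis
    unfolding Pf_graph_def c
  proof (rule pf_cong)
    fix i j assume ij: "i < card S" "j < card S"
    then have "s ! i \<in> S" "s ! j \<in> S" using s by (metis nth_mem)+
    then show "skew_mat w' (h ` S) i j = skew_mat w S i j"
      using ij s(2) assms(3)
      unfolding skew_mat_def sorted_list_of_set_image_strict_mono[OF assms(1,2)] s_def[symmetric]
      by (simp add: Let_def)
  qed
qed

lemma PfS_image:
  assumes "finite S" "strict_mono_on S h" "\<And>a b. a \<in> S \<Longrightarrow> b \<in> S \<Longrightarrow> w' {h a, h b} = w {a, b}" "T \<subseteq> S"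
  shows "PfS w' (h ` S) (h ` T) = PfS w S T"
proof -
  have inj: "inj_on h S" by (rule strict_mono_on_imp_inj_on[OF assms(2)])
  have "PfS w' (h ` S) (h ` T) = (\<Sum>W\<in>(`) h ` Pow T. Pf_graph w' (h ` S - W))"
    unfolding PfS_def by (simp add: image_Pow_surj)
  also have "\<dots> = (\<Sum>W\<in>Pow T. Pf_graph w' (h ` S - h ` W))"
    by (subst sum.reindex) (use inj_on_image_Pow[OF inj_on_subset[OF inj assms(4)]] in auto)
  also have "\<dots> = (\<Sum>W\<in>Pow T. Pf_graph w (S - W))"
  proof (rule sum.cong[OF refl])
    fix W assume "W \<in> Pow T"
    then have "h ` S - h ` W = h ` (S - W)"
      using assms(4) by (intro inj_on_image_set_diff[OF inj, symmetric]) auto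
    moreover have "strict_mono_on (S - W) h"
      using assms(2) by (auto simp: strict_mono_on_def)
    ultimately show "Pf_graph w' (h ` S - h ` W) = Pf_graph w (S - W)"
      using Pf_graph_image[of "S - W" h w' w] assms(1,3) by simp
  qed
  finally show ?thesis unfolding PfS_def .
qed

text \<open>The position is the rank in \<open>V\<close>, raised by one outside the initial segment
  \<open>D\<close>; the number left free is the place of the parity wire.\<close>

lemma position_with_gap:
  fixes V D :: "'a::linorder set"
  assumes "finite V" "D \<subseteq> V" and down: "\<forall>v\<in>D. \<forall>u\<in>V. u \<le> v \<longrightarrow> u \<in> D"
  obtains h :: "'a \<Rightarrow> nat" where "strict_mono_on V h" "h ` V = {..card V} - {card D}"
    "\<And>v. v \<in> V \<Longrightarrow> h v < card D \<longleftrightarrow> v \<in> D"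
proof -
  define r where "r v = card {u\<in>V. u < v}" for v
  define h where "h v = r v + (if v \<in> D then 0 else 1)" for v
  have r: "r u < r v" if "u \<in> V" "u < v" for u v
    unfolding r_def
  proof (rule psubset_card_mono)
    have "u \<in> {x\<in>V. x < v}" "u \<notin> {x\<in>V. x < u}" using that by auto
    moreover have "{x\<in>V. x < u} \<subseteq> {x\<in>V. x < v}" using that by auto
    ultimately show "{x\<in>V. x < u} \<subset> {x\<in>V. x < v}" by blast
  qed (use assms in simp)
  have mono: "strict_mono_on V h"
  proof (rule strict_mono_onI)
    fix u v assume uv: "u \<in> V" "v \<in> V" "u < v"
    have "v \<in> D \<Longrightarrow> u \<in> D" using down uv by auto
    then show "h u < h v" using r[OF uv(1,3)] unfolding h_def by auto
  qed
  have finD: "finite D" by (rule finite_subset[OF assms(2,1)])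
  have inD: "r v < card D" if "v \<in> D" for v
    unfolding r_def
  proof (rule psubset_card_mono[OF finD])
    have "{u\<in>V. u < v} \<subseteq> D" using down that by auto
    then show "{u\<in>V. u < v} \<subset> D" using that by auto
  qed
  have outD: "card D \<le> r v" if "v \<in> V" "v \<notin> D" for v
    unfolding r_def
  proof (rule card_mono)
    show "D \<subseteq> {u\<in>V. u < v}"
    proof
      fix d assume d: "d \<in> D"
      then have "\<not> v \<le> d" using down that by blast
      then show "d \<in> {u\<in>V. u < v}" using d assms(2) by auto
    qed
  qed (use assms in simp)
  have rV: "r v < card V" if "v \<in> V" for v
    unfolding r_def using that assms(1) by (intro psubset_card_mono) auto
  have lt: "h v < card D \<longleftrightarrow> v \<in> D" if "v \<in> V" for v
    using inD[of v] outD[of v] that unfolding h_def by auto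
  have sub: "h ` V \<subseteq> {..card V} - {card D}"
  proof clarify
    fix v assume v: "v \<in> V"
    have "h v \<noteq> card D" using inD[of v] outD[OF v] unfolding h_def by auto
    then show "h v \<in> {..card V} - {card D}" using rV[OF v] unfolding h_def by auto
  qed
  have "card (h ` V) = card V"
    by (rule card_image) (rule strict_mono_on_imp_inj_on[OF mono])
  moreover have "card ({..card V} - {card D}) = card V"
    using card_mono[OF assms(1,2)] by simp
  ultimately have "h ` V = {..card V} - {card D}"
    using sub by (intro card_subset_eq) auto
  then show thesis using that mono lt by blast
qed

theorem theorem8:
  fixes V X T Y :: "'a::linorder set" and w :: "'a set \<Rightarrow> complex" and k :: nat
  assumes "general_matchgate V w X T Y"
    and "k = card (X \<union> Y)"
  shows "\<exists>V1 w1 e1 V2 w2 e2.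
           planar_matchgate V1 w1 e1 \<and> length e1 = k
         \<and> planar_matchgate V2 w2 e2 \<and> length e2 = k
         \<and> (\<forall>\<alpha>::bool list. length \<alpha> = k \<longrightarrow>
               naked_char V w X T Y \<alpha> = signature V1 w1 e1 \<alpha> + signature V2 w2 e2 \<alpha>)"
proof -
  have fin: "finite V" and w: "\<And>e. w e \<noteq> 0 \<Longrightarrow> e \<subseteq> V \<and> card e = 2"
    and sub: "X \<subseteq> V" "T \<subseteq> V" "Y \<subseteq> V" and disj: "X \<inter> T = {}" "T \<inter> Y = {}"
    and ord: "\<And>x t. x \<in> X \<Longrightarrow> t \<in> T \<Longrightarrow> x < t" "\<And>t y. t \<in> T \<Longrightarrow> y \<in> Y \<Longrightarrow> t < y"
    using assms(1) unfolding general_matchgate_def by auto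
  \<comment> \<open>All vertices up to the last omittable one, including any that are neither
    external nor omittable; the parity wire follows directly after them.\<close>
  define D where "D = {v\<in>V. \<exists>t\<in>T. v \<le> t}"
  have DV: "D \<subseteq> V" unfolding D_def by auto
  have down: "\<forall>v\<in>D. \<forall>u\<in>V. u \<le> v \<longrightarrow> u \<in> D" unfolding D_def by (auto intro: order_trans)
  obtain h where h: "strict_mono_on V h" "h ` V = {..card V} - {card D}"
    "\<And>v. v \<in> V \<Longrightarrow> h v < card D \<longleftrightarrow> v \<in> D"
    using position_with_gap[OF fin DV down] by metis
  have inj: "inj_on h V" by (rule strict_mono_on_imp_inj_on[OF h(1)])
  define p where "p = card D"
  \<comment> \<open>One wire for \<open>p\<close> and one spare wire, so that a gate fits even if \<open>V\<close> is empty.\<close>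
  define N where "N = card V + 2"
  have pV: "p \<le> card V" unfolding p_def by (rule card_mono[OF fin DV])
  have hV: "h ` V \<subseteq> {..<N} - {p}" unfolding h(2) N_def p_def by auto
  \<comment> \<open>The weights carried over to wires. Nothing in \<open>V\<close> is sent to
    \<open>p\<close>, so a pair containing \<open>p\<close> pulls back to at most one vertex and
    gets weight 0.\<close>
  define w' where "w' e = w (V \<inter> h -` e)" for e
  have w'h: "w' {h a, h b} = w {a, b}" if "a \<in> V" "b \<in> V" for a b
  proof -
    have "V \<inter> h -` {h a, h b} = {a, b}" using that inj by (auto dest: inj_onD)
    then show ?thesis unfolding w'_def by simp
  qed
  have w'p: "w' {p, x} = 0" for x
  proof (rule ccontr)
    assume "w' {p, x} \<noteq> 0"
    then have "card (V \<inter> h -` {p, x}) = 2" using w unfolding w'_def by blast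
    then obtain a b where ab: "V \<inter> h -` {p, x} = {a, b}" "a \<noteq> b" by (meson card_2_iff)
    then have "a \<in> V" "b \<in> V" "h a \<in> {p, x}" "h b \<in> {p, x}" by blast+
    moreover have "h a \<noteq> p" "h b \<noteq> p" using hV calculation by auto
    ultimately show False using inj ab(2) by (auto dest: inj_onD)
  qed
  have hT: "h ` T \<subseteq> {..<p}" using h(3) sub(2) unfolding p_def D_def by auto
  obtain F where F: "realizable N F" "\<And>S. S \<subseteq> {..<N} - {p} \<Longrightarrow> (\<forall>t\<in>h ` T. {t..<p} \<subseteq> S) \<Longrightarrow>
    PfS w' S (h ` T) = F S + F (insert p S)"
    using realizable_PfS[OF hT, of N w'] w'p pV unfolding N_def by auto
  define es where "es = map h (ext_nodes X Y)"
  have ext: "set (ext_nodes X Y) = X \<union> Y" "length (ext_nodes X Y) = k" "sorted_wrt (<) (ext_nodes X Y)"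
    using fin sub finite_subset[of "X \<union> Y" V] assms(2) unfolding ext_nodes_def by auto
  have es: "sorted_wrt (<) es" "length es = k" "set es \<subseteq> h ` V"
  proof -
    have "h x < h y" if "x \<in> set (ext_nodes X Y)" "y \<in> set (ext_nodes X Y)" "x < y" for x y
      using strict_mono_onD[OF h(1)] that sub unfolding ext(1) by blast
    then show "sorted_wrt (<) es"
      unfolding es_def sorted_wrt_map by (rule sorted_wrt_mono_rel[OF _ ext(3)])
    show "length es = k" "set es \<subseteq> h ` V" unfolding es_def using ext sub by auto
  qed
  have N2: "2 \<le> N" unfolding N_def by simp
  obtain V1 w1 e1 where 1: "planar_matchgate V1 w1 e1" "length e1 = length es"
    "\<And>\<alpha>. length \<alpha> = length es \<Longrightarrow> signature V1 w1 e1 \<alpha> = F (h ` V - {es ! i | i. i < length \<alpha> \<and> \<alpha> ! i})"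
    using realizable_planar[OF F(1) N2 es(1,3)] hV by blast
  have "set es \<subseteq> insert p (h ` V)" "insert p (h ` V) \<subseteq> {..<N}" using es(3) hV pV unfolding N_def by auto
  then obtain V2 w2 e2 where 2: "planar_matchgate V2 w2 e2" "length e2 = length es"
    "\<And>\<alpha>. length \<alpha> = length es \<Longrightarrow>
      signature V2 w2 e2 \<alpha> = F (insert p (h ` V) - {es ! i | i. i < length \<alpha> \<and> \<alpha> ! i})"
    using realizable_planar[OF F(1) N2 es(1)] by blast
  have "naked_char V w X T Y \<alpha> = signature V1 w1 e1 \<alpha> + signature V2 w2 e2 \<alpha>"
    if \<alpha>: "length \<alpha> = k" for \<alpha> :: "bool list"
  proof -
    define Z where "Z = {ext_nodes X Y ! i | i. i < length \<alpha> \<and> \<alpha> ! i}"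
    have Z: "Z \<subseteq> X \<union> Y" using ext \<alpha> nth_mem unfolding Z_def by fastforce
    have ZV: "Z \<subseteq> V" using Z sub by auto
    have TZ: "T \<subseteq> V - Z" using Z sub disj by blast
    have es_Z: "{es ! i | i. i < length \<alpha> \<and> \<alpha> ! i} = h ` Z"
      unfolding Z_def es_def using ext(2) \<alpha> by force
    have hZ: "h ` V - h ` Z = h ` (V - Z)"
      using inj_on_image_set_diff[OF inj, of V Z] ZV by auto
    have pZ: "p \<notin> h ` Z" using hV ZV by blast
    have "naked_char V w X T Y \<alpha> = PfS w (V - Z) T" unfolding naked_char_def Z_def ..
    also have "\<dots> = PfS w' (h ` (V - Z)) (h ` T)"
      by (rule PfS_image[symmetric])
        (use fin h(1) w'h TZ in \<open>auto simp: strict_mono_on_def\<close>)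
    also have "\<dots> = F (h ` (V - Z)) + F (insert p (h ` (V - Z)))"
    proof (rule F(2))
      show "h ` (V - Z) \<subseteq> {..<N} - {p}" using hV by blast
      \<comment> \<open>A vertex lying between an omittable node and the last one is neither an
        input nor an output, so \<open>\<alpha>\<close> never deletes it and its wire is
        occupied.\<close>
      show "\<forall>t\<in>h ` T. {t..<p} \<subseteq> h ` (V - Z)"
      proof clarify
        fix t x assume t: "t \<in> T" and x: "x \<in> {h t..<p}"
        have "x \<in> h ` V" using x pV unfolding h(2) p_def by auto
        then obtain v where v: "v \<in> V" "x = h v" by auto
        then have "v \<in> D" using h(3)[of v] x unfolding p_def by simp
        then obtain t' where t': "t' \<in> T" "v \<le> t'" unfolding D_def by auto
        have "\<not> v < t"
          using strict_mono_onD[OF h(1) v(1), of t] t sub x v(2) by fastforce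
        then have "v \<notin> X" using ord(1)[of v t] t by auto
        moreover have "v \<notin> Y" using ord(2)[of t' v] t' by auto
        ultimately show "x \<in> h ` (V - Z)" using v Z by blast
      qed
    qed
    also have "insert p (h ` (V - Z)) = insert p (h ` V) - h ` Z" using pZ hZ by auto
    also have "F (h ` (V - Z)) + F (insert p (h ` V) - h ` Z) = signature V1 w1 e1 \<alpha> + signature V2 w2 e2 \<alpha>"
      using 1(3)[of \<alpha>] 2(3)[of \<alpha>] \<alpha> es(2) unfolding es_Z hZ by simp
    finally show ?thesis .
  qed
  then show ?thesis using 1 2 es(2) by blast
qed

end
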